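(* Let $n\ge 4$ and $k\ge 1$ be integers, and choose integers $q_{ij}\ge 2$ for all pairs $1\le i<j\le n$. Define $p_0,p_1,p_2,\dots$ by $p_0=1$, $p_1=q_{12}$ and $p_{j+1}=q_{12}p_j-p_{j-1}$ for $j\ge 1$. Let $Q$ be the quiver on the vertex set $\{1,\dots,n\}$ whose exchange matrix $B(Q)=(b_{ij})$ is given, for $1\le i<j\le n$, by $$b_{ij}=\begin{cases}-p_{2k-2}q_{1j}-p_{2k-1}q_{2j} & \text{if } i=1 \text{ and } 3\le j\le n-1,\\ p_{2k-1}q_{1j}+p_{2k}q_{2j} & \text{if } i=2 \text{ and } 3\le j\le n-1,\\ q_{ij} & \text{otherwise},\end{cases}$$ together with $b_{ii}=0$ and $b_{ji}=-b_{ij}$. Then: (1) applying to $Q$ the mutations at the following vertices, in this order, $$n,\ \underbrace{1,2,\dots,1,2}_{\text{the pair }1,2\text{ repeated }k\text{ times}},\ n-1,\ n-2,\ \dots,\ 2,\ 1,\ \underbrace{2,1,\dots,2,1}_{\text{the pair }2,1\text{ repeated }k\text{ times}}$$ returns the quiver $Q$ (so this is a mutation cycle of length $n+4k$ based at $Q$); (2) all $n+4k$ quivers lying on this mutation cycle (i.e. $Q$ and the quivers obtained from $Q$ after applying the first $j$ of these mutations, $1\le j\le n+4k-1$) are pairwise distinct; (3) this mutation cycle cannot be paved by mutation cycles of length $\le 4k$.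
   Context: A quiver on the vertex set $[1,n]=\{1,\dots,n\}$ is a finite directed multigraph with no loops and no oriented 2-cycles; quivers are labeled, i.e. two quivers are equal only if they are equal as labeled graphs. A quiver $Q$ is encoded by the skew-symmetric integer matrix $B(Q)=(b_{ij})$, where $b_{ij}>0$ means there are $b_{ij}$ arrows from $i$ to $j$. Mutation at a vertex $k$ produces the quiver $\mu[k](Q)$ with matrix $b'_{ij}=-b_{ij}$ if $k\in\{i,j\}$ and $b'_{ij}=b_{ij}+\tfrac12(|b_{ik}|b_{kj}+b_{ik}|b_{kj}|)$ otherwise. A mutation cycle of length $N$ based at $Q$ is a sequence $i_1,\dots,i_N$ of vertices with $i_1\ne i_2\ne\cdots\ne i_N\ne i_1$ (consecutive entries distinct, cyclically), such that applying $\mu[i_1]$, then $\mu[i_2]$, ..., then $\mu[i_N]$ to $Q$ returns $Q$, and no mutation is applied at an isolated vertex. The mutation graph of the mutation class of $Q$ has as vertices all quivers obtainable from $Q$ by sequences of mutations, with an edge labeled $i$ joining $Q'$ and $\mu[i](Q')$; a mutation cycle is a closed walk in this graph. A closed walk in the mutation graph is said to be paved by mutation cycles of length $\le L$ if it becomes null-homotopic in the 2-complex obtained from the mutation graph by attaching a 2-cell along every mutation cycle of length $\le L$. *)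

theory Defs
  imports "HOL-Analysis.Analysis"
begin

section \<open>Quivers and mutation\<close>

text \<open>
  A quiver on the vertex set $[1,n]$ is represented by its exchange matrix, extended by zero
  outside $[1,n]$, so that equality of labeled quivers is equality of functions.
\<close>

type_synonym quiver = "nat \<Rightarrow> nat \<Rightarrow> int"

definition is_quiver :: "nat \<Rightarrow> quiver \<Rightarrow> bool" where
  "is_quiver n B \<longleftrightarrow>
     (\<forall>i j. B j i = - B i j) \<and> (\<forall>i j. i \<notin> {1..n} \<or> j \<notin> {1..n} \<longrightarrow> B i j = 0)"

text \<open>The numerator below is always even, so \<open>div\<close> is exact.\<close>

definition mutate :: "nat \<Rightarrow> quiver \<Rightarrow> quiver" where
  "mutate k B = (\<lambda>i j. if i = k \<or> j = k then - B i j
                       else B i j + (\<bar>B i k\<bar> * B k j + B i k * \<bar>B k j\<bar>) div 2)"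

text \<open>Mutations are applied in the order in which they are listed: the head of the list first.\<close>

definition mutate_list :: "nat list \<Rightarrow> quiver \<Rightarrow> quiver" where
  "mutate_list ks B = fold mutate ks B"

definition isolated :: "quiver \<Rightarrow> nat \<Rightarrow> bool" where
  "isolated B v \<longleftrightarrow> (\<forall>j. B v j = 0)"

definition mutation_cycle :: "nat \<Rightarrow> quiver \<Rightarrow> nat list \<Rightarrow> bool" where
  "mutation_cycle n B ks \<longleftrightarrow>
     is_quiver n B \<and> ks \<noteq> [] \<and> set ks \<subseteq> {1..n} \<and>
     (\<forall>j<length ks. ks ! j \<noteq> ks ! (Suc j mod length ks)) \<and>
     (\<forall>j<length ks. \<not> isolated (mutate_list (take j ks) B) (ks ! j)) \<and>
     mutate_list ks B = B"

definition mutation_class :: "nat \<Rightarrow> quiver \<Rightarrow> quiver set" where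
  "mutation_class n B = {mutate_list ks B | ks. set ks \<subseteq> {1..n}}"


section \<open>The mutation graph with attached 2-cells\<close>

text \<open>
  Points of the 2-complex: the vertices of the mutation graph, the interior points of its edges,
  and the interior points of the attached disks (one disk for each based mutation cycle of bounded
  length).  The edge labeled \<open>i\<close> joining \<open>B\<close> and \<open>mutate i B\<close> is unoriented: the point at
  parameter \<open>t\<close> starting from \<open>B\<close> is the point at parameter \<open>1 - t\<close> starting from
  \<open>mutate i B\<close>.  The set component of \<open>EdgePoint\<close> collects these two descriptions.  If
  \<open>mutate i B = B\<close> the edge is a loop and the point has just one description.
\<close>

datatype point =
    Vertex quiver
  | EdgePoint nat "(quiver \<times> real) set"
  | CellPoint quiver "nat list" complex

definition edge_point :: "quiver \<Rightarrow> nat \<Rightarrow> real \<Rightarrow> point" where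
  "edge_point B i t =
     (if t = 0 then Vertex B
      else if t = 1 then Vertex (mutate i B)
      else if mutate i B = B then EdgePoint i {(B, t)}
      else EdgePoint i {(B, t), (mutate i B, 1 - t)})"

text \<open>
  The walk starting at \<open>B\<close> and following the edges labeled \<open>ks\<close>, parametrized by $[0,1]$ with
  constant speed.
\<close>

definition walk_point :: "quiver \<Rightarrow> nat list \<Rightarrow> real \<Rightarrow> point" where
  "walk_point B ks s =
     (let j = nat \<lfloor>real (length ks) * s\<rfloor> in
      if j < length ks
      then edge_point (mutate_list (take j ks) B) (ks ! j) (real (length ks) * s - real j)
      else Vertex (mutate_list ks B))"

text \<open>
  The characteristic map, defined on the closed unit disk, of the 2-cell attached along the
  mutation cycle \<open>ks\<close> based at \<open>B\<close>.
\<close>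

definition cell_point :: "quiver \<Rightarrow> nat list \<Rightarrow> complex \<Rightarrow> point" where
  "cell_point B ks z =
     (if norm z < 1 then CellPoint B ks z else walk_point B ks (Arg2pi z / (2 * pi)))"

definition cells :: "nat \<Rightarrow> nat \<Rightarrow> quiver \<Rightarrow> (quiver \<times> nat list) set" where
  "cells n L Q =
     {(B, ks). B \<in> mutation_class n Q \<and> mutation_cycle n B ks \<and> length ks \<le> L}"

definition complex_points :: "nat \<Rightarrow> nat \<Rightarrow> quiver \<Rightarrow> point set" where
  "complex_points n L Q =
     Vertex ` mutation_class n Q
     \<union> (\<Union>B\<in>mutation_class n Q. \<Union>i\<in>{1..n}. edge_point B i ` {0..1})
     \<union> (\<Union>(B, ks)\<in>cells n L Q. cell_point B ks ` cball 0 1)"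

text \<open>
  The weak (quotient) topology: a set of points is open iff its preimages under the characteristic
  maps of all edges and all 2-cells are open.
\<close>

definition complex_open :: "nat \<Rightarrow> nat \<Rightarrow> quiver \<Rightarrow> point set \<Rightarrow> bool" where
  "complex_open n L Q U \<longleftrightarrow>
     U \<subseteq> complex_points n L Q \<and>
     (\<forall>B\<in>mutation_class n Q. \<forall>i\<in>{1..n}.
        openin (top_of_set {0..1}) {t \<in> {0..1}. edge_point B i t \<in> U}) \<and>
     (\<forall>(B, ks)\<in>cells n L Q.
        openin (top_of_set (cball 0 1)) {z \<in> cball 0 1. cell_point B ks z \<in> U})"

definition mutation_complex :: "nat \<Rightarrow> nat \<Rightarrow> quiver \<Rightarrow> point topology" where
  "mutation_complex n L Q = topology (complex_open n L Q)"

text \<open>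
  The closed walk \<open>ks\<close> based at \<open>B\<close> is null-homotopic, i.e. homotopic through loops to a constant
  loop, in the mutation graph of the class of \<open>Q\<close> with a 2-cell attached along every mutation cycle
  of length at most \<open>L\<close>.  This is
  \<open>homotopic_loops\<close> for an abstract topology.
\<close>

definition paved :: "nat \<Rightarrow> nat \<Rightarrow> quiver \<Rightarrow> quiver \<Rightarrow> nat list \<Rightarrow> bool" where
  "paved n L Q B ks \<longleftrightarrow>
     (\<exists>c. homotopic_with (\<lambda>r. r 0 = r 1) (top_of_set {0..1}) (mutation_complex n L Q)
            (walk_point B ks) (\<lambda>_. c))"

lemma istopology_complex_open: "istopology (complex_open n L Q)"
  unfolding istopology_def
proof (intro conjI allI impI)
  fix S T assume S: "complex_open n L Q S" and T: "complex_open n L Q T"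
  have eq: "{x \<in> A. f x \<in> S \<inter> T} = {x \<in> A. f x \<in> S} \<inter> {x \<in> A. f x \<in> T}"
    for A :: "'a set" and f by auto
  show "complex_open n L Q (S \<inter> T)"
    using S T unfolding complex_open_def eq
    by (auto intro!: openin_Int simp del: atLeastAtMost_iff mem_cball)
next
  fix K assume K: "\<forall>S\<in>K. complex_open n L Q S"
  have eq: "{x \<in> A. f x \<in> \<Union>K} = \<Union>((\<lambda>S. {x \<in> A. f x \<in> S}) ` K)"
    for A :: "'a set" and f by auto
  show "complex_open n L Q (\<Union>K)"
    using K unfolding complex_open_def eq
    by (auto intro!: openin_Union simp del: atLeastAtMost_iff mem_cball)
qed

lemma openin_mutation_complex [simp]: "openin (mutation_complex n L Q) = complex_open n L Q"
  unfolding mutation_complex_def using istopology_complex_open by (rule topology_inverse')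


section \<open>The quiver and the mutation sequence\<close>

fun pseq :: "int \<Rightarrow> nat \<Rightarrow> int" where
  "pseq a 0 = 1"
| "pseq a (Suc 0) = a"
| "pseq a (Suc (Suc j)) = a * pseq a (Suc j) - pseq a j"

definition upper_entry :: "nat \<Rightarrow> nat \<Rightarrow> (nat \<Rightarrow> nat \<Rightarrow> int) \<Rightarrow> nat \<Rightarrow> nat \<Rightarrow> int" where
  "upper_entry n k q i j =
     (let p = pseq (q 1 2) in
      if i = 1 \<and> 3 \<le> j \<and> j \<le> n - 1 then - p (2*k - 2) * q 1 j - p (2*k - 1) * q 2 j
      else if i = 2 \<and> 3 \<le> j \<and> j \<le> n - 1 then p (2*k - 1) * q 1 j + p (2*k) * q 2 j
      else q i j)"

definition long_cycle_quiver :: "nat \<Rightarrow> nat \<Rightarrow> (nat \<Rightarrow> nat \<Rightarrow> int) \<Rightarrow> quiver" where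
  "long_cycle_quiver n k q = (\<lambda>i j.
     if 1 \<le> i \<and> i < j \<and> j \<le> n then upper_entry n k q i j
     else if 1 \<le> j \<and> j < i \<and> i \<le> n then - upper_entry n k q j i
     else 0)"

definition long_cycle :: "nat \<Rightarrow> nat \<Rightarrow> nat list" where
  "long_cycle n k =
     [n] @ concat (replicate k [1, 2]) @ rev [1..<n] @ concat (replicate k [2, 1])"

end

theory Submission
  imports Defs "HOL-Complex_Analysis.Winding_Numbers"
begin

text \<open>
  Mutating \<open>Q\<close>, respectively \<open>mutate n Q\<close>, alternately at 1, 2, 1, 2, \dots gives two lines of \<open>2k + 1\<close>
  quivers, joined at one end by the edge labeled \<open>n\<close> and at the other by the mutations at
  \<open>n - 1, \<dots>, 1\<close>. The numbers of arrows along the lines satisfy the recurrence of \<open>p\<close>, and this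
  yields the cycle and the distinctness of its quivers.

  A closed walk that never repeats a label twice in a row cannot visit a fork, since in one of the two
  directions it would then pass through forks with more and more arrows. Any step that leaves one of the two lines
  before its far end leads to a fork. So a closed walk through the edge labeled \<open>n\<close> at \<open>Q\<close> has to follow
  both lines to their ends, and no mutation cycle of length at most \<open>4k\<close> uses that edge. Hence
  wrapping the edge around the unit circle and collapsing the rest extends continuously over all
  2-cells, and it maps the given cycle to a loop of winding number 1.
\<close>

section \<open>Mutation\<close>

text \<open>The entries of \<open>Q\<close> come from reading the cycle backwards: at the far ends
  of the lines the arrows between 1, 2 and a middle vertex j have the plain multiplicities
  \<open>q 1 j\<close> and \<open>q 2 j\<close>, and undoing 2k alternating mutations turns these
  into the combinations with coefficients \<open>p\<close>. Along the lines each middle vertex forms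
  an oriented 3-cycle with 1 and 2, and this pattern is what turns exits into forks. It first breaks
  at the far ends, where other continuations become possible; this fixes the number of forced steps
  at 2k on each side. The bound 4k is a count: a closed walk that uses the edge and has at most 4k
  steps closes up inside the two forced pieces, so these would share a quiver, which a single sign
  excludes.\<close>

lemma mutate_term:
  "(\<bar>x\<bar> * y + x * \<bar>y\<bar>) div 2 =
     (if 0 < x \<and> 0 < y then x * y else if x < 0 \<and> y < 0 then - (x * y) else 0)"
  for x y :: int
proof -
  have 1: "(z + z) div 2 = z" "(- z - z) div 2 = - z" for z :: int by presburger+
  show ?thesis using 1[of "x * y"] by (auto simp: abs_if)
qed

lemma mutate_eq:
  "mutate k B i j = (if i = k \<or> j = k then - B i j
     else B i j + (if 0 < B i k \<and> 0 < B k j then B i k * B k j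
                   else if B i k < 0 \<and> B k j < 0 then - (B i k * B k j) else 0))"
  unfolding mutate_def mutate_term by simp

lemma mutate_mutate [simp]: "mutate k (mutate k B) = B"
  by (intro ext) (auto simp: mutate_eq)

lemma is_quiver_skew: "is_quiver n B \<Longrightarrow> B j i = - B i j"
  unfolding is_quiver_def by (elim conjE allE)

lemma is_quiver_outside: "is_quiver n B \<Longrightarrow> i \<notin> {1..n} \<or> j \<notin> {1..n} \<Longrightarrow> B i j = 0"
  unfolding is_quiver_def by (elim conjE) (rotate_tac -1, erule allE, erule allE, erule mp)

lemma is_quiver_diag: "is_quiver n B \<Longrightarrow> B i i = 0"
  using is_quiver_skew[of n B i i] by simp

lemma is_quiver_mutate:
  assumes "is_quiver n B"
  shows "is_quiver n (mutate k B)"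
proof -
  have skew: "B j i = - B i j" for i j
    using assms by (rule is_quiver_skew)
  have out: "B i j = 0" if "i \<notin> {1..n} \<or> j \<notin> {1..n}" for i j
    using assms that by (rule is_quiver_outside)
  have "mutate k B j i = - mutate k B i j" for i j
    unfolding mutate_eq using skew[of j i] skew[of j k] skew[of k i] by (auto simp: mult.commute)
  moreover have "mutate k B i j = 0" if "i \<notin> {1..n} \<or> j \<notin> {1..n}" for i j
    using out[OF that] out[of i k] out[of k j] that unfolding mutate_eq by auto
  ultimately show ?thesis unfolding is_quiver_def by blast
qed

text \<open>\<open>B v k\<close> is only negated, so it vanishes; then no path through
  \<open>k\<close> starts at \<open>v\<close>, and row \<open>v\<close> is unchanged up to
  sign.\<close>

lemma isolated_mutateD:
  assumes "is_quiver n B" "isolated (mutate k B) v"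
  shows "isolated B v"
proof -
  have 0: "mutate k B v j = 0" for j using assms(2) by (simp add: isolated_def)
  have "B v k = 0" using 0[of k] by (simp add: mutate_eq)
  then have "B v j = 0" for j
    using 0[of j] by (auto simp: mutate_eq split: if_splits)
  then show ?thesis by (simp add: isolated_def)
qed

lemma mutate_list_simps [simp]:
  "mutate_list [] B = B"
  "mutate_list (k # ks) B = mutate_list ks (mutate k B)"
  "mutate_list (ks @ ks') B = mutate_list ks' (mutate_list ks B)"
  by (simp_all add: mutate_list_def)

lemma isolated_mutate_listD:
  "is_quiver n B \<Longrightarrow> isolated (mutate_list ks B) v \<Longrightarrow> isolated B v"
  by (induction ks arbitrary: B) (auto dest: isolated_mutateD intro: is_quiver_mutate)

lemma mutate_list_take_Suc:
  "j < length ks \<Longrightarrow>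
    mutate_list (take (Suc j) ks) B = mutate (ks ! j) (mutate_list (take j ks) B)"
  by (simp add: take_Suc_conv_app_nth)

section \<open>Forks\<close>

definition abundant :: "nat \<Rightarrow> quiver \<Rightarrow> bool" where
  "abundant n B \<longleftrightarrow> (\<forall>i\<in>{1..n}. \<forall>j\<in>{1..n}. i \<noteq> j \<longrightarrow> 2 \<le> \<bar>B i j\<bar>)"

text \<open>In an abundant quiver, transitivity on a set of vertices amounts to acyclicity.\<close>

definition transitive_on :: "nat \<Rightarrow> quiver \<Rightarrow> (nat \<Rightarrow> bool) \<Rightarrow> bool" where
  "transitive_on n B P \<longleftrightarrow>
     (\<forall>i\<in>{1..n}. \<forall>j\<in>{1..n}. \<forall>l\<in>{1..n}. P i \<and> P j \<and> P l \<and> 0 < B i j \<and> 0 < B j l \<longrightarrow> 0 < B i l)"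

text \<open>Forks and their point of return, after Warkentin: a fork mutated away from its point of
  return is again a fork, with more arrows.\<close>

definition fork :: "nat \<Rightarrow> quiver \<Rightarrow> nat \<Rightarrow> bool" where
  "fork n B r \<longleftrightarrow> is_quiver n B \<and> abundant n B \<and> r \<in> {1..n} \<and>
     (\<exists>i\<in>{1..n}. 0 < B i r) \<and> (\<exists>j\<in>{1..n}. 0 < B r j) \<and>
     transitive_on n B (\<lambda>i. 0 < B i r) \<and> transitive_on n B (\<lambda>j. 0 < B r j) \<and>
     (\<forall>i\<in>{1..n}. \<forall>j\<in>{1..n}. 0 < B i r \<and> 0 < B r j \<longrightarrow> B i r < B j i \<and> B r j < B j i)"

text \<open>The last clause asks that in every oriented 3-cycle through \<open>x\<close> some arrow at \<open>x\<close> has larger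
  multiplicity than the opposite one. This suffices for mutation at \<open>x\<close> to create a fork.\<close>

definition fork_maker :: "nat \<Rightarrow> quiver \<Rightarrow> nat \<Rightarrow> bool" where
  "fork_maker n B x \<longleftrightarrow> is_quiver n B \<and> abundant n B \<and> x \<in> {1..n} \<and>
     (\<exists>i\<in>{1..n}. 0 < B i x) \<and> (\<exists>j\<in>{1..n}. 0 < B x j) \<and>
     transitive_on n B (\<lambda>i. 0 < B i x) \<and> transitive_on n B (\<lambda>j. 0 < B x j) \<and>
     (\<forall>i\<in>{1..n}. \<forall>j\<in>{1..n}. 0 < B i x \<and> 0 < B x j \<longrightarrow> B j i < B i x \<or> B j i < B x j)"

text \<open>Here \<open>x\<close> and \<open>y\<close> are the arrows at the mutated vertex and
  \<open>z\<close> is the opposite arrow of an oriented 3-cycle: what remains after cancellation,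
  \<open>x * y - z\<close>, exceeds both \<open>x\<close> and \<open>y\<close>. This combines (x -
  2)(y - 2) \<ge> 0 with 2x \<le> xy and 2y \<le> xy.\<close>

lemma mult_gt_max_plus:
  fixes x y z :: int
  assumes "2 \<le> x" "2 \<le> y" "z < x \<or> z < y"
  shows "x + z < x * y \<and> y + z < x * y"
proof -
  have "0 \<le> (x - 2) * (y - 2)" using assms by simp
  then have a: "2 * x + 2 * y - 4 \<le> x * y" by (simp add: algebra_simps)
  have b: "x * 2 \<le> x * y" "2 * y \<le> x * y" using assms by (auto intro: mult_left_mono mult_right_mono)
  show ?thesis using a b assms by linarith
qed

lemma abundantD: "abundant n B \<Longrightarrow> i \<in> {1..n} \<Longrightarrow> j \<in> {1..n} \<Longrightarrow> 0 < B i j \<Longrightarrow> is_quiver n B \<Longrightarrow> 2 \<le> B i j"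
  unfolding abundant_def using is_quiver_diag[of n B i] by (cases "i = j") force+

lemma abundant_total: "abundant n B \<Longrightarrow> is_quiver n B \<Longrightarrow> i \<in> {1..n} \<Longrightarrow> j \<in> {1..n} \<Longrightarrow> i \<noteq> j \<Longrightarrow>
    2 \<le> B i j \<or> 2 \<le> B j i"
  using is_quiver_skew[of n B i j] unfolding abundant_def by force

lemma fork_maker_mono:
  assumes fm: "fork_maker n B x" and ij: "i \<in> {1..n}" "j \<in> {1..n}"
    and "0 < B i x" "0 < B x j"
  shows "mutate x B i j = B i j + B i x * B x j" "B i x < mutate x B i j" "B x j < mutate x B i j"
    "\<bar>B i j\<bar> \<le> \<bar>mutate x B i j\<bar> \<or> B i j < 0"
proof -
  have q: "is_quiver n B" "abundant n B" "x \<in> {1..n}" using fm by (auto simp: fork_maker_def)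
  have 2: "2 \<le> B i x" "2 \<le> B x j"
    using abundantD q ij assms by blast+
  have "B j i < B i x \<or> B j i < B x j" using fm assms unfolding fork_maker_def by blast
  then have "B i x + B j i < B i x * B x j \<and> B x j + B j i < B i x * B x j"
    using mult_gt_max_plus 2 by blast
  moreover show "mutate x B i j = B i j + B i x * B x j"
    using assms by (auto simp: mutate_eq is_quiver_diag[OF q(1)])
  moreover have "B j i = - B i j" using q(1) is_quiver_skew by blast
  ultimately show "B i x < mutate x B i j" "B x j < mutate x B i j"
    "\<bar>B i j\<bar> \<le> \<bar>mutate x B i j\<bar> \<or> B i j < 0" using 2 by auto
qed

text \<open>Arrows between two sources or between two targets of \<open>x\<close> are untouched, so
  transitivity survives with the two sides exchanged. A path i -> x -> j turns into a 3-cycle i -> j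
  -> x -> i, whose arrow opposite \<open>x\<close> is the largest by
  \<open>fork_maker_mono\<close>.\<close>

lemma fork_mutate:
  assumes fm: "fork_maker n B x"
  shows "fork n (mutate x B) x"
proof -
  let ?B = "mutate x B"
  have q: "is_quiver n B" and ab: "abundant n B" and x: "x \<in> {1..n}"
    and tr: "transitive_on n B (\<lambda>i. 0 < B i x)" "transitive_on n B (\<lambda>j. 0 < B x j)"
    using fm by (auto simp: fork_maker_def)
  have sk: "B j i = - B i j" for i j using q by (rule is_quiver_skew)
  have q': "is_quiver n ?B" using q by (rule is_quiver_mutate)
  have sk': "?B j i = - ?B i j" for i j using q' by (rule is_quiver_skew)
  have flip: "?B i x = B x i" "?B x i = B i x" for i
    using sk[of i x] by (auto simp: mutate_eq)
  note mono = fork_maker_mono[OF fm]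
  have same: "?B i j = B i j" if "0 < B i x \<and> 0 < B j x \<or> 0 < B x i \<and> 0 < B x j" for i j
    using that sk[of i x] sk[of j x] by (auto simp: mutate_eq is_quiver_diag[OF q])
  have "2 \<le> \<bar>?B i j\<bar>" if ij: "i \<in> {1..n}" "j \<in> {1..n}" "i \<noteq> j" for i j
  proof (cases "i = x \<or> j = x")
    case True
    then show ?thesis using ab ij by (auto simp: mutate_eq abundant_def)
  next
    case False
    then have "2 \<le> B i x \<or> 2 \<le> B x i" "2 \<le> B j x \<or> 2 \<le> B x j"
      using abundant_total[OF ab q] ij x by blast+
    then consider "2 \<le> B i x" "2 \<le> B j x" | "2 \<le> B x i" "2 \<le> B x j"
      | "2 \<le> B i x" "2 \<le> B x j" | "2 \<le> B x i" "2 \<le> B j x" by blast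
    then show ?thesis
    proof cases
      case 3
      then show ?thesis using mono(2)[OF ij(1,2)] by simp
    next
      case 4
      then show ?thesis using mono(2)[OF ij(2,1)] sk'[of i j] by simp
    qed (use same[of i j] ab ij in \<open>auto simp: abundant_def\<close>)
  qed
  then have "abundant n ?B" by (auto simp: abundant_def)
  moreover have "transitive_on n ?B (\<lambda>i. 0 < ?B i x)" "transitive_on n ?B (\<lambda>i. 0 < ?B x i)"
    using tr unfolding flip transitive_on_def by (metis same)+
  moreover have "?B i x < ?B j i \<and> ?B x j < ?B j i"
    if "i \<in> {1..n}" "j \<in> {1..n}" "0 < ?B i x \<and> 0 < ?B x j" for i j
    using mono(2,3)[OF that(2,1)] that unfolding flip by simp
  ultimately show ?thesis
    using fm q' x unfolding fork_def flip fork_maker_def by blast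
qed

section \<open>Growth of the number of arrows along forks\<close>

definition arrow_count :: "nat \<Rightarrow> quiver \<Rightarrow> int" where
  "arrow_count n B = (\<Sum>i\<in>{1..n}. \<Sum>j\<in>{1..n}. \<bar>B i j\<bar>)"

lemma mutate_minus: "mutate k (\<lambda>i j. - B i j) = (\<lambda>i j. - mutate k B i j)"
  by (intro ext) (auto simp: mutate_eq)

text \<open>Reversing all arrows commutes with mutation and preserves forks and arrow numbers, so a
  mutation at a source of the point of return reduces to one at a target.\<close>

definition opposite :: "quiver \<Rightarrow> quiver" where
  "opposite B = (\<lambda>i j. B j i)"

lemma opposite_eq: "is_quiver n B \<Longrightarrow> opposite B = (\<lambda>i j. - B i j)"
  unfolding opposite_def by (intro ext) (rule is_quiver_skew)

lemma is_quiver_opposite: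
  assumes "is_quiver n B"
  shows "is_quiver n (opposite B)"
  unfolding is_quiver_def opposite_def
proof (intro conjI allI impI)
  fix i j
  show "B i j = - B j i" using assms by (rule is_quiver_skew)
  assume "i \<notin> {1..n} \<or> j \<notin> {1..n}"
  then have "j \<notin> {1..n} \<or> i \<notin> {1..n}" by blast
  then show "B j i = 0" using assms is_quiver_outside by blast
qed

lemma abundant_opposite: "abundant n B \<Longrightarrow> abundant n (opposite B)"
  unfolding abundant_def opposite_def by metis

lemma transitive_on_opposite: "transitive_on n B P \<Longrightarrow> transitive_on n (opposite B) P"
  unfolding transitive_on_def opposite_def by blast

lemma fork_opposite: "fork n B r \<Longrightarrow> fork n (opposite B) r"
  unfolding fork_def
  by (elim conjE, intro conjI is_quiver_opposite abundant_opposite transitive_on_opposite)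
    (simp_all add: opposite_def)

lemma fork_maker_opposite: "fork_maker n B r \<Longrightarrow> fork_maker n (opposite B) r"
  unfolding fork_maker_def
  by (elim conjE, intro conjI is_quiver_opposite abundant_opposite transitive_on_opposite)
    (auto simp add: opposite_def)

text \<open>Since r -> k, the fork inequality yields k -> i for each source i of \<open>r\<close>.
  Hence the sources of \<open>k\<close> are \<open>r\<close> and targets of \<open>r\<close>, while
  among the targets of \<open>k\<close> the targets of \<open>r\<close> precede its sources; both
  sets are transitive. The only oriented 3-cycles through \<open>k\<close> are r -> k -> j -> r,
  where \<open>B j r < B k j\<close>.\<close>

lemma fork_maker_fork_aux:
  assumes f: "fork n B r" and k: "k \<in> {1..n}" "0 < B r k"
  shows "fork_maker n B k" "\<exists>i\<in>{1..n}. 0 < B i r \<and> 0 < B k i"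
proof -
  have q: "is_quiver n B" and ab: "abundant n B" and r: "r \<in> {1..n}"
    and tr: "transitive_on n B (\<lambda>i. 0 < B i r)" "transitive_on n B (\<lambda>i. 0 < B r i)"
    and f3: "\<And>i j. i \<in> {1..n} \<Longrightarrow> j \<in> {1..n} \<Longrightarrow> 0 < B i r \<Longrightarrow> 0 < B r j \<Longrightarrow> B i r < B j i \<and> B r j < B j i"
    using f by (auto simp: fork_def)
  have sk: "B j i = - B i j" for i j using q by (rule is_quiver_skew)
  have tot: "0 < B i j \<or> 0 < B j i \<or> i = j" if "i \<in> {1..n}" "j \<in> {1..n}" for i j
    using abundant_total[OF ab q that] by force
  obtain i0 where i0: "i0 \<in> {1..n}" "0 < B i0 r" using f by (auto simp: fork_def)
  have ki0: "0 < B k i0" using f3[OF i0(1) k(1) i0(2) k(2)] k by simp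
  then show "\<exists>i\<in>{1..n}. 0 < B i r \<and> 0 < B k i" using i0 by blast
  have asym: "\<not> (0 < B i j \<and> 0 < B j i)" for i j using sk[of i j] by simp
  have inD: "i = r \<or> 0 < B r i" if "i \<in> {1..n}" "0 < B i k" for i
    using f3[OF that(1) k(1)] tot[OF that(1) r] asym[of i k] k that by force
  have tr1: "transitive_on n B (\<lambda>i. 0 < B i k)"
    unfolding transitive_on_def
  proof (intro ballI impI)
    fix i j l assume V: "i \<in> {1..n}" "j \<in> {1..n}" "l \<in> {1..n}"
      and a: "0 < B i k \<and> 0 < B j k \<and> 0 < B l k \<and> 0 < B i j \<and> 0 < B j l"
    show "0 < B i l"
      using inD[OF V(1)] inD[OF V(2)] inD[OF V(3)] a tr(2) V asym unfolding transitive_on_def by metis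
  qed
  have tr2: "transitive_on n B (\<lambda>i. 0 < B k i)"
    unfolding transitive_on_def
  proof (intro ballI impI)
    fix i j l assume V: "i \<in> {1..n}" "j \<in> {1..n}" "l \<in> {1..n}"
      and a: "0 < B k i \<and> 0 < B k j \<and> 0 < B k l \<and> 0 < B i j \<and> 0 < B j l"
    have s: "0 < B x r \<or> 0 < B r x" if "x \<in> {1..n}" "0 < B k x" for x
      using tot[OF that(1) r] that k asym by blast
    have f3': "0 < B y x" if "x \<in> {1..n}" "y \<in> {1..n}" "0 < B x r" "0 < B r y" for x y
      using f3[OF that] that by simp
    show "0 < B i l"
      using s[OF V(1)] s[OF V(2)] s[OF V(3)] a tr V asym f3' unfolding transitive_on_def by metis
  qed
  have "B j i < B i k \<or> B j i < B k j" if V: "i \<in> {1..n}" "j \<in> {1..n}" and a: "0 < B i k \<and> 0 < B k j" for i j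
  proof (cases "0 < B i j")
    case True
    then show ?thesis using a sk[of i j] by simp
  next
    case False
    have ne: "i \<noteq> j" using a asym by blast
    then have ji: "0 < B j i" using tot[OF V] False by blast
    show ?thesis
    proof (cases "i = r")
      case True
      then show ?thesis using f3[OF V(2) k(1)] ji k(2) by simp
    next
      case F: False
      then have ri: "0 < B r i" using inD[of i] V a by blast
      have "j \<noteq> r" using a k asym by blast
      then consider "0 < B r j" | "0 < B j r" using tot[OF V(2) r] by blast
      then show ?thesis
      proof cases
        case 1
        then have "0 < B i j" using tr(2) ri k a V unfolding transitive_on_def by blast
        then show ?thesis using False by blast
      next
        case 2
        then have "0 < B i j" using f3[OF V(2,1) 2 ri] by simp
        then show ?thesis using False by blast
      qed
    qed
  qed
  then show "fork_maker n B k"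
    unfolding fork_maker_def using q ab k tr1 tr2 r i0 ki0 by blast
qed

text \<open>A path i -> k -> j either runs parallel to an arrow i -> j, which then gains, or closes
  up through i = r. In the latter case the new entry exceeds \<open>B k j\<close>, which already
  exceeds \<open>B j r\<close>. The second conclusion of \<open>fork_maker_fork_aux\<close> supplies
  an entry of the latter kind, hence strictness.\<close>

lemma arrow_count_mutate_fork_aux:
  assumes f: "fork n B r" and k: "k \<in> {1..n}" "0 < B r k"
  shows "arrow_count n B < arrow_count n (mutate k B)"
proof -
  have q: "is_quiver n B" and ab: "abundant n B" and r: "r \<in> {1..n}"
    and tr: "transitive_on n B (\<lambda>i. 0 < B i r)" "transitive_on n B (\<lambda>i. 0 < B r i)"
    and f3: "\<And>i j. i \<in> {1..n} \<Longrightarrow> j \<in> {1..n} \<Longrightarrow> 0 < B i r \<Longrightarrow> 0 < B r j \<Longrightarrow> B i r < B j i \<and> B r j < B j i"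
    using f by (auto simp: fork_def)
  have fm: "fork_maker n B k" using fork_maker_fork_aux(1)[OF assms] .
  let ?B = "mutate k B"
  have sk: "B j i = - B i j" for i j using q by (rule is_quiver_skew)
  have sk': "?B j i = - ?B i j" for i j using is_quiver_mutate[OF q] by (rule is_quiver_skew)
  have asym: "\<not> (0 < B i j \<and> 0 < B j i)" for i j using sk[of i j] by simp
  have tot: "0 < B i j \<or> 0 < B j i \<or> i = j" if "i \<in> {1..n}" "j \<in> {1..n}" for i j
    using abundant_total[OF ab q that] by force
  note mono = fork_maker_mono[OF fm]
  have path: "\<bar>B i j\<bar> \<le> \<bar>?B i j\<bar> \<and> (i = r \<and> 0 < B j r \<longrightarrow> \<bar>B i j\<bar> < \<bar>?B i j\<bar>)"
    if V: "i \<in> {1..n}" "j \<in> {1..n}" and a: "0 < B i k" "0 < B k j" for i j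
  proof (cases "i = r \<and> 0 < B j r")
    case True
    then have "B j r < B k j" using f3[OF V(2) k(1)] k by simp
    then show ?thesis using mono(3)[OF V a] True sk[of r j] by auto
  next
    case False
    have "\<not> 0 < B j i"
    proof
      assume ji: "0 < B j i"
      have "i \<noteq> r" using False ji by blast
      then have ri: "0 < B r i" using f3[OF V(1) k(1)] tot[OF V(1) r] asym[of i k] k a by force
      have "j \<noteq> r" using a k asym by blast
      then consider "0 < B r j" | "0 < B j r" using tot[OF V(2) r] by blast
      then show False
      proof cases
        case 1
        then have "0 < B i j" using tr(2) ri k a V unfolding transitive_on_def by blast
        then show ?thesis using asym ji by blast
      next
        case 2
        then have "0 < B i j" using f3[OF V(2,1) 2 ri] by simp
        then show ?thesis using asym ji by blast
      qed
    qed
    then show ?thesis using mono(4)[OF V a] False sk[of i j] by auto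
  qed
  have le: "\<bar>B i j\<bar> \<le> \<bar>?B i j\<bar>" if V: "i \<in> {1..n}" "j \<in> {1..n}" for i j
  proof -
    consider "0 < B i k" "0 < B k j" | "0 < B j k" "0 < B k i" | "?B i j = B i j \<or> ?B i j = - B i j"
      using sk[of i k] sk[of k j] by (force simp: mutate_eq)
    then show ?thesis
    proof cases
      case 2
      then show ?thesis using path[OF V(2,1)] sk[of i j] sk'[of i j] by simp
    qed (use path[OF V] in auto)
  qed
  obtain i where i: "i \<in> {1..n}" "0 < B i r" "0 < B k i" using fork_maker_fork_aux(2)[OF assms] by blast
  have lt: "\<bar>B r i\<bar> < \<bar>?B r i\<bar>" using path[OF r i(1) k(2) i(3)] i by blast
  have "(\<Sum>j\<in>{1..n}. \<bar>B r j\<bar>) < (\<Sum>j\<in>{1..n}. \<bar>?B r j\<bar>)"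
    using le r lt i by (intro sum_strict_mono_ex1) auto
  then show ?thesis
    unfolding arrow_count_def using le r by (intro sum_strict_mono_ex1) (auto intro!: sum_mono)
qed

lemma fork_step:
  assumes f: "fork n B r" and k: "k \<in> {1..n}" "k \<noteq> r"
  shows "fork n (mutate k B) k" "arrow_count n B < arrow_count n (mutate k B)"
proof -
  have q: "is_quiver n B" and ab: "abundant n B" and r: "r \<in> {1..n}" using f by (auto simp: fork_def)
  have neg: "arrow_count n (\<lambda>i j. - X i j) = arrow_count n X" for X
    by (simp add: arrow_count_def)
  consider "0 < B r k" | "0 < - B r k"
    using abundant_total[OF ab q r k(1)] k is_quiver_skew[OF q, of r k] by force
  then have "fork_maker n B k \<and> arrow_count n B < arrow_count n (mutate k B)"
  proof cases
    case 1
    then show ?thesis using fork_maker_fork_aux arrow_count_mutate_fork_aux assms by blast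
  next
    case 2
    have k2: "0 < opposite B r k" using 2 by (simp add: opposite_eq[OF q])
    have oo: "opposite (opposite B) = B" by (simp add: opposite_def)
    note f' = fork_opposite[OF f]
    have "arrow_count n (opposite B) < arrow_count n (mutate k (opposite B))"
      using arrow_count_mutate_fork_aux[OF f' k(1) k2] .
    moreover have "fork_maker n B k"
      using fork_maker_opposite[OF fork_maker_fork_aux(1)[OF f' k(1) k2]] unfolding oo .
    ultimately show ?thesis
      by (simp add: opposite_eq[OF q] mutate_minus neg)
  qed
  then show "fork n (mutate k B) k" "arrow_count n B < arrow_count n (mutate k B)"
    using fork_mutate by auto
qed

section \<open>Closed walks avoid forks\<close>

text \<open>A closed walk is unrolled to a periodic bi-infinite one, so that reversing it
  and changing its base point become substitutions.\<close>

definition reduced_loop :: "nat \<Rightarrow> int \<Rightarrow> (int \<Rightarrow> nat) \<Rightarrow> (int \<Rightarrow> quiver) \<Rightarrow> bool" where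
  "reduced_loop n N l s \<longleftrightarrow> 0 < N \<and>
     (\<forall>i. l i \<in> {1..n} \<and> s (i + 1) = mutate (l i) (s i) \<and> l i \<noteq> l (i + 1) \<and> s (i + N) = s i)"

lemma reduced_loop_shift:
  assumes "reduced_loop n N l s"
  shows "reduced_loop n N (\<lambda>i. l (i + d)) (\<lambda>i. s (i + d))"
proof -
  have "i + N + d = (i + d) + N" "i + 1 + d = (i + d) + 1" for i by simp_all
  then show ?thesis using assms unfolding reduced_loop_def by metis
qed

text \<open>Mutations are involutions. The step from index - i to - i - 1 undoes the one labeled
  \<open>l (- i - 1)\<close>, whence the offset in the labels.\<close>

lemma reduced_loop_reverse:
  assumes "reduced_loop n N l s"
  shows "reduced_loop n N (\<lambda>i. l (- i - 1)) (\<lambda>i. s (- i))"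
  unfolding reduced_loop_def
proof (intro conjI allI)
  fix i
  have st: "s (j + 1) = mutate (l j) (s j)" "l j \<noteq> l (j + 1)" "s (j + N) = s j" for j
    using assms by (auto simp: reduced_loop_def)
  show "s (- (i + 1)) = mutate (l (- i - 1)) (s (- i))"
    using st(1)[of "- i - 1"] mutate_mutate by simp
  show "l (- i - 1) \<noteq> l (- (i + 1) - 1)"
  proof -
    have "- i - 2 + 1 = - i - 1" "- (i + 1) - 1 = - i - 2" by simp_all
    then show ?thesis using st(2)[of "- i - 2"] by metis
  qed
  show "s (- (i + N)) = s (- i)"
    using st(3)[of "- i - N"] by simp
qed (use assms in \<open>auto simp: reduced_loop_def\<close>)

text \<open>After each step the point of return is the label just used, and the next label differs
  from it. So the walk never turns back and gains arrows forever, against periodicity.\<close>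

lemma reduced_loop_no_fork_aux:
  assumes rl: "reduced_loop n N l s" and f: "fork n (s 0) r" and ne: "l 0 \<noteq> r"
  shows False
proof -
  have st: "l j \<in> {1..n}" "s (j + 1) = mutate (l j) (s j)" "l j \<noteq> l (j + 1)" "s (j + N) = s j" for j
    using rl by (auto simp: reduced_loop_def)
  have "fork n (s (int m + 1)) (l (int m)) \<and> arrow_count n (s 0) < arrow_count n (s (int m + 1))" for m
  proof (induction m)
    case 0
    show ?case using fork_step[OF f st(1) ne] st(2)[of 0] by simp
  next
    case (Suc m)
    then have "fork n (s (int m + 1)) (l (int m))" by blast
    from fork_step[OF this st(1) st(3)[symmetric]]
    show ?case using Suc st(2)[of "int m + 1"] by (simp add: algebra_simps)
  qed
  \<comment> \<open>This value of \<open>m\<close> gives the index \<open>N\<close>, where the walk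
    is back at \<open>s 0\<close>.\<close>
  from this[of "nat (N - 1)"] show False
    using rl st(4)[of 0] by (simp add: reduced_loop_def)
qed

text \<open>The labels before and after index \<open>i\<close> differ, so one of them is not
  \<open>r\<close>: in that direction the walk leaves the fork away from its point of
  return.\<close>

lemma reduced_loop_no_fork:
  assumes rl: "reduced_loop n N l s"
  shows "\<not> fork n (s i) r"
proof
  assume f: "fork n (s i) r"
  have "l i \<noteq> l (i - 1)" using rl unfolding reduced_loop_def by (metis diff_add_cancel)
  then consider "l i \<noteq> r" | "l (i - 1) \<noteq> r" by metis
  then show False
  proof cases
    case 1
    then show False
      using reduced_loop_no_fork_aux[OF reduced_loop_shift[OF rl, of i]] f by simp
  next
    case 2
    then show False
      using reduced_loop_no_fork_aux[OF reduced_loop_reverse[OF reduced_loop_shift[OF rl, of i]]] f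
      by simp
  qed
qed

lemma reduced_loop_mutation_cycle:
  assumes "mutation_cycle n B ks"
  shows "reduced_loop n (length ks) (\<lambda>i. ks ! nat (i mod length ks))
    (\<lambda>i. mutate_list (take (nat (i mod length ks)) ks) B)"
  unfolding reduced_loop_def
proof (intro conjI allI)
  let ?N = "length ks"
  have mc: "ks \<noteq> []" "set ks \<subseteq> {1..n}" "\<And>j. j < ?N \<Longrightarrow> ks ! j \<noteq> ks ! (Suc j mod ?N)"
    "mutate_list ks B = B"
    using assms by (auto simp: mutation_cycle_def)
  then show pos: "0 < int ?N" by simp
  fix i :: int
  define m where "m = nat (i mod ?N)"
  have m: "m < ?N" "int m = i mod ?N" using pos by (auto simp: m_def nat_less_iff)
  have Sm: "nat ((i + 1) mod ?N) = Suc m mod ?N"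
    using m by (metis mod_add_left_eq nat_int of_nat_Suc of_nat_mod add.commute)
  show "ks ! nat (i mod ?N) \<in> {1..n}" using m mc(2) nth_mem[of m ks] unfolding m_def[symmetric] by blast
  show "ks ! nat (i mod ?N) \<noteq> ks ! nat ((i + 1) mod ?N)"
    unfolding Sm using mc(3) m by (simp flip: m_def)
  show "mutate_list (take (nat ((i + 1) mod ?N)) ks) B =
      mutate (ks ! nat (i mod ?N)) (mutate_list (take (nat (i mod ?N)) ks) B)"
    unfolding Sm m_def[symmetric] mutate_list_take_Suc[OF m(1), symmetric]
    using m(1) mc(4) by (cases "Suc m = ?N") auto
qed simp

section \<open>A winding number obstruction to paving\<close>

text \<open>Wraps the edge labeled \<open>v\<close> at \<open>B\<close> once around the unit circle and collapses everything else
  to 1. It is continuous as soon as no 2-cell is attached along that edge.\<close>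

definition wrap_edge :: "quiver \<Rightarrow> nat \<Rightarrow> point \<Rightarrow> complex" where
  "wrap_edge B v P =
     (if \<exists>t. P = EdgePoint v {(B, t), (mutate v B, 1 - t)}
      then cis (2 * pi * (THE t. P = EdgePoint v {(B, t), (mutate v B, 1 - t)})) else 1)"

text \<open>The unordered pair of descriptions determines the parameter because the two quivers
  differ; this is why the wrapped edge is assumed not to be a loop.\<close>

lemma edge_description_inject:
  assumes "B \<noteq> C" "{(B, t), (C, 1 - t)} = {(B, u), (C, 1 - u :: real)}"
  shows "t = u"
  using assms by (auto simp: doubleton_eq_iff)

lemma wrap_edge_EdgePoint:
  assumes "mutate v B \<noteq> B"
  shows "wrap_edge B v (EdgePoint v {(B, t), (mutate v B, 1 - t)}) = cis (2 * pi * t)"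
proof -
  have "(THE u. EdgePoint v {(B, t), (mutate v B, 1 - t)} = EdgePoint v {(B, u), (mutate v B, 1 - u)}) = t"
    using edge_description_inject[OF assms[symmetric]] by (intro the_equality) auto
  then show ?thesis by (auto simp: wrap_edge_def)
qed

lemma wrap_edge_Vertex [simp]: "wrap_edge B v (Vertex C) = 1"
  by (simp add: wrap_edge_def)

lemma wrap_edge_CellPoint [simp]: "wrap_edge B v (CellPoint C ks z) = 1"
  by (simp add: wrap_edge_def)

lemma norm_wrap_edge: "norm (wrap_edge B v P) = 1"
  by (simp add: wrap_edge_def)

lemma wrap_edge_edge_point:
  assumes "mutate v B \<noteq> B"
  shows "wrap_edge B v (edge_point C i t) =
    (if i = v \<and> C = B then cis (2 * pi * t)
     else if i = v \<and> C = mutate v B then cis (2 * pi * (1 - t)) else 1)"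
proof -
  have cis0: "cis (2 * pi) = 1" by (simp add: complex_eq_iff)
  consider "t = 0 \<or> t = 1" | "t \<noteq> 0" "t \<noteq> 1" "i = v" "C = B"
    | "t \<noteq> 0" "t \<noteq> 1" "i = v" "C = mutate v B"
    | "t \<noteq> 0" "t \<noteq> 1" "\<not> (i = v \<and> (C = B \<or> C = mutate v B))" by blast
  then show ?thesis
  proof cases
    case 1
    then show ?thesis by (auto simp: edge_point_def cis0)
  next
    case 2
    then show ?thesis using wrap_edge_EdgePoint[OF assms] assms by (simp add: edge_point_def)
  next
    case 3
    then show ?thesis using wrap_edge_EdgePoint[OF assms, of "1 - t"] assms
      by (simp add: edge_point_def insert_commute)
  next
    case 4
    then have "\<nexists>u. edge_point C i t = EdgePoint v {(B, u), (mutate v B, 1 - u)}"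
      using assms by (auto simp: edge_point_def doubleton_eq_iff)
    then show ?thesis using 4 by (auto simp: wrap_edge_def)
  qed
qed

lemma edge_point_in_complex:
  "B \<in> mutation_class n Q \<Longrightarrow> i \<in> {1..n} \<Longrightarrow> t \<in> {0..1} \<Longrightarrow> edge_point B i t \<in> complex_points n L Q"
  unfolding complex_points_def by blast

lemma cell_point_in_complex:
  "(B, ks) \<in> cells n L Q \<Longrightarrow> z \<in> cball 0 1 \<Longrightarrow> cell_point B ks z \<in> complex_points n L Q"
  unfolding complex_points_def by blast

lemma topspace_mutation_complex: "topspace (mutation_complex n L Q) = complex_points n L Q"
proof -
  have "complex_open n L Q (complex_points n L Q)"
    unfolding complex_open_def
  proof (intro conjI ballI subset_refl)
    fix B i assume "B \<in> mutation_class n Q" "i \<in> {1..n}"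
    then have "{t \<in> {0..1}. edge_point B i t \<in> complex_points n L Q} = {0..1}"
      using edge_point_in_complex[of B n Q i] by auto
    then show "openin (top_of_set {0..1}) {t \<in> {0..1}. edge_point B i t \<in> complex_points n L Q}"
      by (simp only: openin_subtopology_self)
  next
    fix c assume c: "c \<in> cells n L Q"
    obtain B ks where [simp]: "c = (B, ks)" by (cases c)
    have "{z \<in> cball 0 1. cell_point B ks z \<in> complex_points n L Q} = cball 0 1"
      using c cell_point_in_complex[of B ks n L Q] by auto
    then show "case c of (B, ks) \<Rightarrow> openin (top_of_set (cball 0 1))
        {z \<in> cball 0 1. cell_point B ks z \<in> complex_points n L Q}"
      unfolding \<open>c = (B, ks)\<close> case_prod_conv by (simp only: openin_subtopology_self)
  qed
  then have "openin (mutation_complex n L Q) (complex_points n L Q)" by simp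
  then have "complex_points n L Q \<subseteq> topspace (mutation_complex n L Q)" by (rule openin_subset)
  moreover have "complex_open n L Q (topspace (mutation_complex n L Q))"
    using openin_topspace[of "mutation_complex n L Q"] by simp
  then have "topspace (mutation_complex n L Q) \<subseteq> complex_points n L Q"
    unfolding complex_open_def by (rule conjunct1)
  ultimately show ?thesis by (intro subset_antisym)
qed

lemma wrap_edge_walk_point:
  assumes "\<And>j. j < length ks \<Longrightarrow> ks ! j = v \<Longrightarrow> mutate_list (take j ks) C \<notin> {B, mutate v B}"
    and "mutate v B \<noteq> B"
  shows "wrap_edge B v (walk_point C ks s) = 1"
  using assms by (auto simp: walk_point_def Let_def wrap_edge_edge_point)

text \<open>The weak topology reduces continuity to closed edges and closed disks. On an edge the
  composite is constant or one turn of the circle; on a disk it is constantly 1, as the boundary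
  walk never uses the wrapped edge.\<close>

lemma continuous_map_wrap_edge:
  assumes ne: "mutate v B \<noteq> B"
    and avoid: "\<And>C ks j. (C, ks) \<in> cells n L Q \<Longrightarrow> j < length ks \<Longrightarrow> ks ! j = v \<Longrightarrow>
      mutate_list (take j ks) C \<notin> {B, mutate v B}"
  shows "continuous_map (mutation_complex n L Q) euclidean (wrap_edge B v)"
  unfolding continuous_map_def topspace_mutation_complex
proof (intro conjI allI impI)
  fix U :: "complex set" assume "openin euclidean U"
  then have U: "open U" by simp
  have "complex_open n L Q {x \<in> complex_points n L Q. wrap_edge B v x \<in> U}"
    unfolding complex_open_def
  proof (intro conjI ballI)
    fix C i assume C: "C \<in> mutation_class n Q" "i \<in> {1..n}"
    then have eq: "{t \<in> {0..1}. edge_point C i t \<in> {x \<in> complex_points n L Q. wrap_edge B v x \<in> U}} =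
        {0..1} \<inter> (\<lambda>t. wrap_edge B v (edge_point C i t)) -` U"
      using edge_point_in_complex[OF C] by auto
    have "continuous_on {0..1} (\<lambda>t. wrap_edge B v (edge_point C i t))"
      unfolding wrap_edge_edge_point[OF ne] cis_conv_exp
      by (cases "i = v \<and> C = B"; cases "i = v \<and> C = mutate v B") (auto intro!: continuous_intros)
    then show "openin (top_of_set {0..1})
        {t \<in> {0..1}. edge_point C i t \<in> {x \<in> complex_points n L Q. wrap_edge B v x \<in> U}}"
      unfolding eq using U by (rule continuous_openin_preimage_gen)
  next
    fix c assume c: "c \<in> cells n L Q"
    obtain C ks where [simp]: "c = (C, ks)" by (cases c)
    have "wrap_edge B v (walk_point C ks s) = 1" for s
      using c by (intro wrap_edge_walk_point[OF avoid[of C ks] ne]) simp_all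
    then have 1: "wrap_edge B v (cell_point C ks z) = 1" for z
      by (simp add: cell_point_def)
    have "cell_point C ks z \<in> complex_points n L Q" if "z \<in> cball 0 1" for z
      using cell_point_in_complex[OF _ that] c by simp
    then have "{z \<in> cball 0 1. cell_point C ks z \<in> {x \<in> complex_points n L Q. wrap_edge B v x \<in> U}} =
        (if 1 \<in> U then cball 0 1 else {})"
      using 1 by auto
    then show "case c of (C, ks) \<Rightarrow> openin (top_of_set (cball 0 1))
        {z \<in> cball 0 1. cell_point C ks z \<in> {x \<in> complex_points n L Q. wrap_edge B v x \<in> U}}"
      unfolding \<open>c = (C, ks)\<close> case_prod_conv by (simp only: openin_subtopology_self openin_empty simp_thms split: if_split)
  qed blast
  then show "openin (mutation_complex n L Q) {x \<in> complex_points n L Q. wrap_edge B v x \<in> U}" by simp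
qed auto

lemma not_paved_if_edge_avoided:
  assumes ne: "mutate v B \<noteq> B" and v: "v \<notin> set ks"
    and avoid: "\<And>C ks j. (C, ks) \<in> cells n L Q \<Longrightarrow> j < length ks \<Longrightarrow> ks ! j = v \<Longrightarrow>
      mutate_list (take j ks) C \<notin> {B, mutate v B}"
  shows "\<not> paved n L Q B (v # ks)"
proof
  let ?N = "real (Suc (length ks))"
  let ?g = "wrap_edge B v \<circ> walk_point B (v # ks)"
  \<comment> \<open>The wrapped edge occupies the first of \<open>?N\<close> equal time intervals;
    afterwards the image rests at 1. So \<open>?g\<close> is the unit circle reparametrized by
    \<open>?h\<close>.\<close>
  let ?h = "\<lambda>s. min 1 (?N * s)"
  assume "paved n L Q B (v # ks)"
  then obtain c where c: "homotopic_with (\<lambda>r. r 0 = r 1) (top_of_set {0..1}) (mutation_complex n L Q)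
      (walk_point B (v # ks)) (\<lambda>_. c)" by (auto simp: paved_def)
  have "continuous_map (mutation_complex n L Q) (top_of_set (- {0})) (wrap_edge B v)"
  proof -
    have "wrap_edge B v P \<noteq> 0" for P using norm_wrap_edge[of B v P] by auto
    moreover have "continuous_map (mutation_complex n L Q) euclidean (wrap_edge B v)"
      by (rule continuous_map_wrap_edge[OF ne]) (rule avoid)
    ultimately show ?thesis
      unfolding continuous_map_in_subtopology by (simp add: Pi_iff)
  qed
  from homotopic_with_compose_continuous_map_left[OF c this,
      where q = "\<lambda>r. pathfinish r = pathstart r"]
  have "homotopic_loops (- {0}) ?g (wrap_edge B v \<circ> (\<lambda>_. c))"
    unfolding homotopic_loops_def by (auto simp: pathfinish_def pathstart_def)
  then have "winding_number ?g 0 = winding_number (wrap_edge B v \<circ> (\<lambda>_. c)) 0"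
    by (rule winding_number_homotopic_loops)
  also have "\<dots> = 0"
    using norm_wrap_edge[of B v c] by (intro winding_number_constI[where c = "wrap_edge B v c"]) auto
  finally have 0: "winding_number ?g 0 = 0" .
  have g: "?g s = circlepath 0 1 (?h s)" if "s \<in> {0..1}" for s
  proof (cases "?N * s < 1")
    case True
    moreover from this have "\<lfloor>?N * s\<rfloor> = 0" using that by (simp add: floor_eq_iff)
    ultimately show ?thesis
      by (simp add: walk_point_def Let_def wrap_edge_edge_point[OF ne] circlepath cis_conv_exp mult_ac)
  next
    case False
    define j where "j = nat \<lfloor>?N * s\<rfloor>"
    have "1 \<le> j" using False unfolding j_def by linarith
    then have nv: "(v # ks) ! j \<noteq> v" if "j < length (v # ks)"
      using v nth_mem[of "j - 1" ks] that by (auto simp: nth_Cons')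
    have "?g s = wrap_edge B v (if j < length (v # ks)
        then edge_point (mutate_list (take j (v # ks)) B) ((v # ks) ! j) (?N * s - real j)
        else Vertex (mutate_list (v # ks) B))"
      by (simp only: walk_point_def Let_def j_def o_apply length_Cons)
    also have "\<dots> = 1"
    proof (cases "j < length (v # ks)")
      case True
      then show ?thesis
        unfolding if_P[OF True] wrap_edge_edge_point[OF ne] using nv[OF True] by argo
    next
      case False
      then show ?thesis by (simp only: if_False wrap_edge_Vertex)
    qed
    finally have "?g s = 1" .
    then show ?thesis using False by (simp add: circlepath)
  qed
  have hc: "continuous_on {0..1} ?h" by (intro continuous_intros)
  have "homotopic_paths (- {0}) (circlepath 0 1) ?g"
  proof (rule homotopic_paths_reparametrize[where f = ?h])
    show "path_image (circlepath 0 1) \<subseteq> - {0 :: complex}" by auto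
    show "?h \<in> {0..1} \<rightarrow> {0..1}" by auto
  qed (use g hc in simp_all)
  then have "winding_number ?g 0 = winding_number (circlepath 0 1) 0"
    by (intro winding_number_homotopic_paths[symmetric])
  also have "\<dots> = 1" by (rule winding_number_circlepath_centre) simp
  finally show False using 0 by simp
qed

section \<open>Quivers with two distinguished vertices\<close>

text \<open>The shape of the quivers met while mutating alternately at 1 and 2: \<open>u\<close> is the vertex
  mutated next and \<open>v\<close> the other one of 1, 2. Since \<open>A\<close>, \<open>B\<close>, \<open>R\<close>, \<open>S\<close>, \<open>D\<close> may be negative, the
  direction of the arrows is encoded in the order of the indices.\<close>

definition strip_shape ::
  "nat \<Rightarrow> (nat \<Rightarrow> nat \<Rightarrow> int) \<Rightarrow> nat \<Rightarrow> nat \<Rightarrow> int \<Rightarrow> (nat \<Rightarrow> int) \<Rightarrow> (nat \<Rightarrow> int) \<Rightarrow>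
    int \<Rightarrow> int \<Rightarrow> (nat \<Rightarrow> int) \<Rightarrow> quiver \<Rightarrow> bool" where
  "strip_shape n q u v a A B R S D X \<longleftrightarrow> is_quiver n X \<and> X u v = a \<and> X n u = R \<and> X v n = S \<and>
     (\<forall>j. 3 \<le> j \<and> j < n \<longrightarrow> X j u = A j \<and> X v j = B j \<and> X j n = D j) \<and>
     (\<forall>i j. 3 \<le> i \<and> i < j \<and> j < n \<longrightarrow> X i j = q i j)"

lemma vertex_set:
  assumes "4 \<le> n" "u = 1 \<and> v = 2 \<or> u = 2 \<and> v = (1::nat)"
  shows "{1..n} = {u, v, n} \<union> {3..<n}"
  using assms by auto

lemma all_vertices:
  assumes "4 \<le> n" "u = 1 \<and> v = 2 \<or> u = 2 \<and> v = (1::nat)"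
  shows "(\<forall>i\<in>{1..n}. P i) \<longleftrightarrow> P u \<and> P v \<and> P n \<and> (\<forall>i. 3 \<le> i \<longrightarrow> i < n \<longrightarrow> P i)"
  unfolding vertex_set[OF assms] by auto

lemma strip_shape_entries:
  assumes sh: "strip_shape n q u v a A B R S D X"
  shows "X u v = a" "X v u = - a" "X n u = R" "X u n = - R" "X v n = S" "X n v = - S"
    "X u u = 0" "X v v = 0" "X n n = 0"
    "\<And>j. 3 \<le> j \<Longrightarrow> j < n \<Longrightarrow> X j u = A j" "\<And>j. 3 \<le> j \<Longrightarrow> j < n \<Longrightarrow> X u j = - A j"
    "\<And>j. 3 \<le> j \<Longrightarrow> j < n \<Longrightarrow> X v j = B j" "\<And>j. 3 \<le> j \<Longrightarrow> j < n \<Longrightarrow> X j v = - B j"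
    "\<And>j. 3 \<le> j \<Longrightarrow> j < n \<Longrightarrow> X j n = D j" "\<And>j. 3 \<le> j \<Longrightarrow> j < n \<Longrightarrow> X n j = - D j"
    "\<And>i j. 3 \<le> i \<Longrightarrow> i < n \<Longrightarrow> 3 \<le> j \<Longrightarrow> j < n \<Longrightarrow>
       X i j = (if i < j then q i j else if j < i then - q j i else 0)"
proof -
  have q: "is_quiver n X" using sh by (simp add: strip_shape_def)
  note sk = is_quiver_skew[OF q]
  show "X u v = a" "X n u = R" "X v n = S"
    and 1: "\<And>j. 3 \<le> j \<Longrightarrow> j < n \<Longrightarrow> X j u = A j" "\<And>j. 3 \<le> j \<Longrightarrow> j < n \<Longrightarrow> X v j = B j"
      "\<And>j. 3 \<le> j \<Longrightarrow> j < n \<Longrightarrow> X j n = D j"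
    using sh by (auto simp: strip_shape_def)
  then show "X v u = - a" "X u n = - R" "X n v = - S"
    using sk[of u v] sk[of n u] sk[of v n] by simp_all
  show "X u u = 0" "X v v = 0" "X n n = 0" using is_quiver_diag[OF q] by auto
  show "X u j = - A j" "X j v = - B j" "X n j = - D j" if "3 \<le> j" "j < n" for j
    using 1[OF that] sk[of j u] sk[of v j] sk[of j n] by simp_all
  show "X i j = (if i < j then q i j else if j < i then - q j i else 0)"
    if "3 \<le> i" "i < n" "3 \<le> j" "j < n" for i j
  proof -
    have qq: "X i j = q i j" if "3 \<le> i" "i < j" "j < n" for i j
      using sh that by (auto simp: strip_shape_def)
    show ?thesis
      using qq[of i j] qq[of j i] sk[of i j] is_quiver_diag[OF q, of i] that
      by (cases i j rule: linorder_cases) auto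
  qed
qed

lemma strip_shape_unique:
  assumes n: "4 \<le> n" "u = 1 \<and> v = 2 \<or> u = 2 \<and> v = (1::nat)"
    and sh: "strip_shape n q u v a A B R S D X" "strip_shape n q u v a A B R S D Y"
  shows "X = Y"
proof -
  note e = strip_shape_entries[OF sh(1)] strip_shape_entries[OF sh(2)]
  have qu: "is_quiver n X" "is_quiver n Y" using sh by (auto simp: strip_shape_def)
  have "\<forall>i\<in>{1..n}. \<forall>j\<in>{1..n}. X i j = Y i j"
    unfolding all_vertices[OF n] by (intro conjI allI impI) (simp_all only: e)
  then have "X i j = Y i j" for i j
    using is_quiver_outside[OF qu(1), of i j] is_quiver_outside[OF qu(2), of i j] by metis
  then show ?thesis by blast
qed

text \<open>All middle vertices are sources of \<open>u\<close>, so no path through \<open>u\<close>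
  joins two of them and the block \<open>q\<close> persists, while \<open>u\<close> and
  \<open>v\<close> exchange roles. The two maxima separate the paths n -> u -> v, present for R > 0,
  from j -> u -> n, present for R < 0.\<close>

lemma strip_shape_mutate:
  assumes n: "4 \<le> n" and uv: "u = 1 \<and> v = 2 \<or> u = 2 \<and> v = (1::nat)"
    and sh: "strip_shape n q u v a A B R S D X"
    and pos: "0 < a" "\<And>j. 3 \<le> j \<Longrightarrow> j < n \<Longrightarrow> 0 < A j"
  shows "strip_shape n q v u a (\<lambda>j. a * A j - B j) A (a * max R 0 - S) R
    (\<lambda>j. D j + A j * max (- R) 0) (mutate u X)"
proof -
  note e = strip_shape_entries[OF sh]
  have ne: "u \<noteq> v" "u < 3" "u \<noteq> n" "v < 3" "v \<noteq> n" "\<And>j. 3 \<le> j \<Longrightarrow> j \<noteq> u" using n uv by auto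
  have qu: "is_quiver n X" using sh by (auto simp: strip_shape_def)
  show ?thesis
    unfolding strip_shape_def
  proof (intro conjI allI impI; (elim conjE)?)
    show "is_quiver n (mutate u X)" using qu by (rule is_quiver_mutate)
    show "mutate u X v u = a" "mutate u X u n = R" by (simp_all add: mutate_eq e)
    show "mutate u X n v = a * max R 0 - S" using ne pos by (auto simp: mutate_eq e)
    fix j assume j: "3 \<le> j" "j < n"
    show "mutate u X j v = a * A j - B j" "mutate u X u j = A j"
      "mutate u X j n = D j + A j * max (- R) 0"
      using ne ne(6)[OF j(1)] pos(1) pos(2)[OF j] j by (auto simp: mutate_eq e)
  next
    fix i j assume ij: "3 \<le> i" "i < j" "j < n"
    then have "0 < A i" "0 < A j" "i < n" "3 \<le> j" using pos(2) by auto
    then show "mutate u X i j = q i j"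
      using ij ne(6)[of i] ne(6)[of j] by (auto simp: mutate_eq e)
  qed
qed

lemma transitive_on_rank:
  assumes q: "is_quiver n B" and ab: "abundant n B"
    and rank: "\<forall>i\<in>{1..n}. \<forall>j\<in>{1..n}. P i \<longrightarrow> P j \<longrightarrow> 0 < B i j \<longrightarrow> \<rho> i < (\<rho> j :: nat)"
  shows "transitive_on n B P"
  unfolding transitive_on_def
proof (intro ballI impI)
  fix i j l assume V: "i \<in> {1..n}" "j \<in> {1..n}" "l \<in> {1..n}"
    and P: "P i \<and> P j \<and> P l \<and> 0 < B i j \<and> 0 < B j l"
  then have lt: "\<rho> i < \<rho> l" using rank by (meson order.strict_trans)
  moreover from lt have "\<not> 0 < B l i" using rank P V by (meson order.asym)
  ultimately show "0 < B i l" using abundant_total[OF ab q V(1,3)] by force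
qed

text \<open>Ranks reduce the cubic transitivity conditions to conditions on pairs of vertices, which
  can be checked by running through the kinds of vertices.\<close>

lemma fork_makerI:
  assumes "is_quiver n B" "abundant n B" "x \<in> {1..n}"
    "i \<in> {1..n}" "0 < B i x" "j \<in> {1..n}" "0 < B x j"
    "\<forall>i\<in>{1..n}. \<forall>j\<in>{1..n}. 0 < B i x \<longrightarrow> 0 < B j x \<longrightarrow> 0 < B i j \<longrightarrow> \<rho> i < (\<rho> j :: nat)"
    "\<forall>i\<in>{1..n}. \<forall>j\<in>{1..n}. 0 < B x i \<longrightarrow> 0 < B x j \<longrightarrow> 0 < B i j \<longrightarrow> \<sigma> i < (\<sigma> j :: nat)"
    "\<forall>i\<in>{1..n}. \<forall>j\<in>{1..n}. 0 < B i x \<longrightarrow> 0 < B x j \<longrightarrow> 0 < B j i \<longrightarrow> B j i < B i x \<or> B j i < B x j"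
  shows "fork_maker n B x"
  unfolding fork_maker_def using assms transitive_on_rank[OF assms(1,2,8)]
    transitive_on_rank[OF assms(1,2,9)] by (meson linorder_not_less order.strict_trans1)

text \<open>A quiver on one of the lines before its far end: there \<open>A\<close> and
  \<open>B\<close> are positive. \<open>R\<close>, \<open>S\<close> and \<open>D\<close> are bounded
  in absolute value only, since their signs vary along the lines.\<close>

locale strip =
  fixes n :: nat and q :: "nat \<Rightarrow> nat \<Rightarrow> int" and u v :: nat and a :: int
    and A B :: "nat \<Rightarrow> int" and R S :: int and D :: "nat \<Rightarrow> int" and X :: quiver
  assumes n: "4 \<le> n" and uv: "u = 1 \<and> v = 2 \<or> u = 2 \<and> v = 1"
    and shape: "strip_shape n q u v a A B R S D X"
    and a: "2 \<le> a" and R: "2 \<le> \<bar>R\<bar>" and S: "2 \<le> \<bar>S\<bar>"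
    and AB: "\<And>j. 3 \<le> j \<Longrightarrow> j < n \<Longrightarrow> 2 \<le> A j" "\<And>j. 3 \<le> j \<Longrightarrow> j < n \<Longrightarrow> 2 \<le> B j"
    and D: "\<And>j. 3 \<le> j \<Longrightarrow> j < n \<Longrightarrow> 2 \<le> \<bar>D j\<bar>"
    and q: "\<And>i j. 3 \<le> i \<Longrightarrow> i < j \<Longrightarrow> j < n \<Longrightarrow> 2 \<le> q i j"
begin

lemmas entries = strip_shape_entries[OF shape]
lemmas all_vs = all_vertices[OF n uv]

lemma quiver: "is_quiver n X"
  using shape by (auto simp: strip_shape_def)

lemma uv_facts: "u \<noteq> v" "v \<noteq> u" "u < 3" "v < 3" "u < n" "v < n" "u \<noteq> n" "v \<noteq> n" "n \<noteq> u" "n \<noteq> v"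
  "u \<in> {1..n}" "v \<in> {1..n}" "n \<in> {1..n}"
  "3 \<le> j \<Longrightarrow> j \<noteq> u" "3 \<le> j \<Longrightarrow> j \<noteq> v" "3 \<le> j \<Longrightarrow> u < j" "3 \<le> j \<Longrightarrow> v < j"
  using n uv by auto

lemma signs: "0 < a" "\<not> a < 0" "3 \<le> j \<Longrightarrow> j < n \<Longrightarrow> 0 < A j" "3 \<le> j \<Longrightarrow> j < n \<Longrightarrow> \<not> A j < 0"
  "3 \<le> j \<Longrightarrow> j < n \<Longrightarrow> 0 < B j" "3 \<le> j \<Longrightarrow> j < n \<Longrightarrow> \<not> B j < 0"
  "3 \<le> i \<Longrightarrow> i < j \<Longrightarrow> j < n \<Longrightarrow> 0 < q i j" "3 \<le> i \<Longrightarrow> i < j \<Longrightarrow> j < n \<Longrightarrow> \<not> q i j < 0"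
  using a AB[of j] q[of i j] by auto

lemma abs_bounds: "2 \<le> \<bar>a\<bar>" "3 \<le> j \<Longrightarrow> j < n \<Longrightarrow> 2 \<le> \<bar>A j\<bar>" "3 \<le> j \<Longrightarrow> j < n \<Longrightarrow> 2 \<le> \<bar>B j\<bar>"
  "3 \<le> i \<Longrightarrow> i < j \<Longrightarrow> j < n \<Longrightarrow> 2 \<le> \<bar>q i j\<bar>"
  using a AB[of j] q[of i j] by auto

lemma abundant: "abundant n X"
  unfolding abundant_def all_vs
  by (auto simp: entries abs_bounds R S D)

text \<open>In the remaining lemmas the ranks order the sources and the targets of the arrows at the
  mutated vertex topologically.\<close>

lemma fork_maker_middle_pos:
  assumes x: "3 \<le> x" "x < n" and aB: "a < B x"
    and D: "\<And>j. 3 \<le> j \<Longrightarrow> j < n \<Longrightarrow> 0 < D j" and S: "- S < D x"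
  shows "fork_maker n X x"
proof (rule fork_makerI[OF quiver abundant,
      where i = v and j = u
      and \<rho> = "\<lambda>i. i"
      and \<sigma> = "\<lambda>i. if i = u then n + 1 else if i = n then (if R < 0 then n + 2 else n) else i"])
  have Ds: "3 \<le> j \<Longrightarrow> j < n \<Longrightarrow> 0 < D j" "3 \<le> j \<Longrightarrow> j < n \<Longrightarrow> \<not> D j < 0" for j
    using D[of j] by auto
  show "x \<in> {1..n}" using x by simp
  show "v \<in> {1..n}" "u \<in> {1..n}" by (rule uv_facts)+
  show "0 < X v x" "0 < X x u" using x signs by (simp_all add: entries)
  show "\<forall>i\<in>{1..n}. \<forall>j\<in>{1..n}. 0 < X i x \<longrightarrow> 0 < X j x \<longrightarrow> 0 < X i j \<longrightarrow>
      (\<lambda>i. i) i < (\<lambda>i. i) j"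
    unfolding all_vs using x S R by (auto simp: entries uv_facts signs Ds)
  show "\<forall>i\<in>{1..n}. \<forall>j\<in>{1..n}. 0 < X x i \<longrightarrow> 0 < X x j \<longrightarrow> 0 < X i j \<longrightarrow>
      (\<lambda>i. if i = u then n + 1 else if i = n then (if R < 0 then n + 2 else n) else i) i < (\<lambda>i. if i = u then n + 1 else if i = n then (if R < 0 then n + 2 else n) else i) j"
    unfolding all_vs using x S R by (auto simp: entries uv_facts signs Ds)
  \<comment> \<open>The oriented 3-cycles through \<open>x\<close> are v -> x -> u -> v, settled by
    \<open>a < B x\<close>, and, if S < 0, v -> x -> n -> v, settled by
    \<open>- S < D x\<close>.\<close>
  show "\<forall>i\<in>{1..n}. \<forall>j\<in>{1..n}. 0 < X i x \<longrightarrow> 0 < X x j \<longrightarrow> 0 < X j i \<longrightarrow> X j i < X i x \<or> X j i < X x j"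
    unfolding all_vs using x aB S R by (auto simp: entries uv_facts signs Ds)
qed

text \<open>Now n points to \<open>u\<close> and to all middle vertices, so no oriented 3-cycle
  contains both \<open>x\<close> and n; v -> x -> u -> v is again settled by
  \<open>a < B x\<close>.\<close>

lemma fork_maker_middle_neg:
  assumes x: "3 \<le> x" "x < n" and aB: "a < B x"
    and D: "\<And>j. 3 \<le> j \<Longrightarrow> j < n \<Longrightarrow> D j < 0" and R_pos: "0 < R"
  shows "fork_maker n X x"
proof (rule fork_makerI[OF quiver abundant,
      where i = v and j = u
      and \<rho> = "\<lambda>i. if i = v then 1 else if i = n then (if 0 < S then 2 else 0) else i"
      and \<sigma> = "\<lambda>i. if i = u then n else i"])
  have Ds: "3 \<le> j \<Longrightarrow> j < n \<Longrightarrow> D j < 0" "3 \<le> j \<Longrightarrow> j < n \<Longrightarrow> \<not> 0 < D j" for j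
    using D[of j] by auto
  show "x \<in> {1..n}" using x by simp
  show "v \<in> {1..n}" "u \<in> {1..n}" by (rule uv_facts)+
  show "0 < X v x" "0 < X x u" using x signs by (simp_all add: entries)
  show "\<forall>i\<in>{1..n}. \<forall>j\<in>{1..n}. 0 < X i x \<longrightarrow> 0 < X j x \<longrightarrow> 0 < X i j \<longrightarrow>
      (\<lambda>i. if i = v then 1 else if i = n then (if 0 < S then 2 else 0) else i) i < (\<lambda>i. if i = v then 1 else if i = n then (if 0 < S then 2 else 0) else i) j"
    unfolding all_vs using x R_pos by (auto simp: entries uv_facts signs Ds)
  show "\<forall>i\<in>{1..n}. \<forall>j\<in>{1..n}. 0 < X x i \<longrightarrow> 0 < X x j \<longrightarrow> 0 < X i j \<longrightarrow>
      (\<lambda>i. if i = u then n else i) i < (\<lambda>i. if i = u then n else i) j"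
    unfolding all_vs using x R_pos by (auto simp: entries uv_facts signs Ds)
  show "\<forall>i\<in>{1..n}. \<forall>j\<in>{1..n}. 0 < X i x \<longrightarrow> 0 < X x j \<longrightarrow> 0 < X j i \<longrightarrow> X j i < X i x \<or> X j i < X x j"
    unfolding all_vs using x aB R_pos by (auto simp: entries uv_facts signs Ds)
qed

text \<open>The only oriented 3-cycle through n is v -> n -> u -> v, where \<open>R\<close> beats
  \<open>a\<close>.\<close>

lemma fork_maker_last_neg:
  assumes RS: "a < R" "0 < R" "0 < S" and D: "\<And>j. 3 \<le> j \<Longrightarrow> j < n \<Longrightarrow> D j < 0"
  shows "fork_maker n X n"
proof -
  have Ds: "3 \<le> j \<Longrightarrow> j < n \<Longrightarrow> D j < 0" "3 \<le> j \<Longrightarrow> j < n \<Longrightarrow> \<not> 0 < D j" for j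
    using D[of j] by auto
  show ?thesis
  proof (rule fork_makerI[OF quiver abundant,
        where i = v and j = u and \<rho> = "\<lambda>i. i" and \<sigma> = "\<lambda>i. if i = u then n else i"])
    show "n \<in> {1..n}" "v \<in> {1..n}" "u \<in> {1..n}" using n uv_facts by auto
    show "0 < X v n" "0 < X n u" using n by (simp_all add: entries signs Ds RS)
  qed (unfold all_vs, use RS a in \<open>auto simp: entries uv_facts signs Ds\<close>)
qed

lemma fork_maker_last_pos:
  assumes RS: "a < R" "0 < R" "0 < S" and D: "\<And>j. 3 \<le> j \<Longrightarrow> j < n \<Longrightarrow> 0 < D j"
  shows "fork_maker n X n"
proof -
  have Ds: "3 \<le> j \<Longrightarrow> j < n \<Longrightarrow> 0 < D j" "3 \<le> j \<Longrightarrow> j < n \<Longrightarrow> \<not> D j < 0" for j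
    using D[of j] by auto
  show ?thesis
  proof (rule fork_makerI[OF quiver abundant,
        where i = v and j = u and \<rho> = "\<lambda>i. i" and \<sigma> = "\<lambda>i. i"])
    show "n \<in> {1..n}" "v \<in> {1..n}" "u \<in> {1..n}" using n uv_facts by auto
    show "0 < X v n" "0 < X n u" using n by (simp_all add: entries signs Ds RS)
  qed (unfold all_vs, use RS a in \<open>auto simp: entries uv_facts signs Ds\<close>)
qed

text \<open>The oriented 3-cycles through n are j -> n -> v -> j with j in the middle, where
  \<open>D j\<close> beats \<open>B j\<close>.\<close>

lemma fork_maker_last_out:
  assumes RS: "R < 0" "S < 0" and D: "\<And>j. 3 \<le> j \<Longrightarrow> j < n \<Longrightarrow> 0 < D j" and BD: "\<And>j. 3 \<le> j \<Longrightarrow> j < n \<Longrightarrow> B j < D j"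
  shows "fork_maker n X n"
proof -
  have Ds: "3 \<le> j \<Longrightarrow> j < n \<Longrightarrow> 0 < D j" "3 \<le> j \<Longrightarrow> j < n \<Longrightarrow> \<not> D j < 0" for j
    using D[of j] by auto
  show ?thesis
  proof (rule fork_makerI[OF quiver abundant,
        where i = u and j = v and \<rho> = "\<lambda>i. if i = u then n else i" and \<sigma> = "\<lambda>i. i"])
    show "n \<in> {1..n}" "u \<in> {1..n}" "v \<in> {1..n}" using n uv_facts by auto
    show "0 < X u n" "0 < X n v" using n by (simp_all add: entries signs Ds RS)
  qed (unfold all_vs, use RS a BD in \<open>auto simp: entries uv_facts signs Ds\<close>)
qed

lemma fork_maker_last_in:
  assumes RS: "0 < R" "S < 0" and D: "\<And>j. 3 \<le> j \<Longrightarrow> j < n \<Longrightarrow> 0 < D j" and BD: "\<And>j. 3 \<le> j \<Longrightarrow> j < n \<Longrightarrow> B j < D j"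
  shows "fork_maker n X n"
proof -
  have Ds: "3 \<le> j \<Longrightarrow> j < n \<Longrightarrow> 0 < D j" "3 \<le> j \<Longrightarrow> j < n \<Longrightarrow> \<not> D j < 0" for j
    using D[of j] by auto
  show ?thesis
  proof (rule fork_makerI[OF quiver abundant,
        where i = 3 and j = u and \<rho> = "\<lambda>i. i" and \<sigma> = "\<lambda>i. if i = u then 0 else 1"])
    show "n \<in> {1..n}" "3 \<in> {1..n}" "u \<in> {1..n}" using n uv_facts by auto
    show "0 < X 3 n" "0 < X n u" using n by (simp_all add: entries signs Ds RS)
  qed (unfold all_vs, use RS a BD in \<open>auto simp: entries uv_facts signs Ds\<close>)
qed

text \<open>The oriented 3-cycles through \<open>v\<close> are u -> v -> j -> u with j in the
  middle, where \<open>B j\<close> beats \<open>A j\<close>.\<close>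

lemma fork_maker_target_pos:
  assumes RS: "R < 0" "0 < S" and D: "\<And>j. 3 \<le> j \<Longrightarrow> j < n \<Longrightarrow> 0 < D j" and AB: "\<And>j. 3 \<le> j \<Longrightarrow> j < n \<Longrightarrow> A j < B j"
  shows "fork_maker n X v"
proof -
  have Ds: "3 \<le> j \<Longrightarrow> j < n \<Longrightarrow> 0 < D j" "3 \<le> j \<Longrightarrow> j < n \<Longrightarrow> \<not> D j < 0" for j
    using D[of j] by auto
  show ?thesis
  proof (rule fork_makerI[OF quiver abundant,
        where i = u and j = n and \<rho> = "\<lambda>i. i" and \<sigma> = "\<lambda>i. i"])
    show "v \<in> {1..n}" "u \<in> {1..n}" "n \<in> {1..n}" using n uv_facts by auto
    show "0 < X u v" "0 < X v n" using n by (simp_all add: entries signs Ds RS)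
  qed (unfold all_vs, use RS a AB in \<open>auto simp: entries uv_facts signs Ds\<close>)
qed

lemma fork_maker_target_neg:
  assumes RS: "0 < R" "S < 0" and D: "\<And>j. 3 \<le> j \<Longrightarrow> j < n \<Longrightarrow> D j < 0" and AB: "\<And>j. 3 \<le> j \<Longrightarrow> j < n \<Longrightarrow> A j < B j"
  shows "fork_maker n X v"
proof -
  have Ds: "3 \<le> j \<Longrightarrow> j < n \<Longrightarrow> D j < 0" "3 \<le> j \<Longrightarrow> j < n \<Longrightarrow> \<not> 0 < D j" for j
    using D[of j] by auto
  show ?thesis
  proof (rule fork_makerI[OF quiver abundant,
        where i = u and j = 3 and \<rho> = "\<lambda>i. if i = u then 1 else 0" and \<sigma> = "\<lambda>i. i"])
    show "v \<in> {1..n}" "u \<in> {1..n}" "3 \<in> {1..n}" using n uv_facts by auto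
    show "0 < X u v" "0 < X v 3" using n by (simp_all add: entries signs Ds RS)
  qed (unfold all_vs, use RS a AB in \<open>auto simp: entries uv_facts signs Ds\<close>)
qed

end

section \<open>The two lines of alternating mutations\<close>

text \<open>With the recurrence continued to $p_{-1} = 0$, $p_{-2} = -1$, the \<open>i\<close>-th term of the sequence
  starting with \<open>- x, y\<close> is $p_{i-2} x + p_{i-1} y$.\<close>

fun lrec :: "int \<Rightarrow> int \<Rightarrow> int \<Rightarrow> nat \<Rightarrow> int" where
  "lrec a x y 0 = x"
| "lrec a x y (Suc 0) = y"
| "lrec a x y (Suc (Suc i)) = a * lrec a x y (Suc i) - lrec a x y i"

text \<open>As a \<ge> 2, the recurrence is convex where its terms are positive, so an initial
  increase persists.\<close>

lemma lrec_increasing: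
  assumes "2 \<le> a" "x \<le> - 2" "2 \<le> y"
  shows "2 \<le> lrec a x y (Suc i) \<and> lrec a x y i < lrec a x y (Suc i)"
proof (induction i)
  case (Suc i)
  then have "2 * lrec a x y (Suc i) \<le> a * lrec a x y (Suc i)"
    using assms by (intro mult_right_mono) auto
  then show ?case using Suc by (simp only: lrec.simps) linarith
qed (use assms in simp)

lemma lrec_ge2: "2 \<le> a \<Longrightarrow> x \<le> - 2 \<Longrightarrow> 2 \<le> y \<Longrightarrow> 1 \<le> i \<Longrightarrow> 2 \<le> lrec a x y i"
  using lrec_increasing[of a x y "i - 1"] by simp

lemma lrec_less: "2 \<le> a \<Longrightarrow> x \<le> - 2 \<Longrightarrow> 2 \<le> y \<Longrightarrow> i < j \<Longrightarrow> lrec a x y i < lrec a x y j"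
  using lift_Suc_mono_less[of "lrec a x y" i j] lrec_increasing by simp

lemma lrec_gt:
  assumes "2 \<le> a" "x \<le> - 2" "2 \<le> y" "2 \<le> i"
  shows "a < lrec a x y i"
proof -
  have "a * 1 \<le> a * y" using assms by (intro mult_left_mono) auto
  then have "a < a * y - x" using assms by linarith
  then have "a < lrec a x y 2" by (simp add: numeral_2_eq_2)
  also have "\<dots> \<le> lrec a x y i"
    using lrec_less[OF assms(1-3), of 2 i] assms(4) by (cases "i = 2") auto
  finally show ?thesis .
qed

lemma lrec_pseq: "lrec a (- x) y (Suc (Suc i)) = pseq a i * x + pseq a (Suc i) * y"
proof (induction i rule: pseq.induct[of _ a])
  case (3 a i)
  have "lrec a (- x) y (Suc (Suc (Suc (Suc i)))) =
      a * lrec a (- x) y (Suc (Suc (Suc i))) - lrec a (- x) y (Suc (Suc i))" by simp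
  then show ?case unfolding 3 by (simp add: algebra_simps)
qed (auto simp: algebra_simps)

text \<open>Both sides solve the same second-order recurrence in \<open>i\<close>, so agreement at 0
  and 1 suffices. The identity later makes the two computations of the arrows between j and n agree
  where the cycle closes.\<close>

lemma lrec_exchange:
  "y * lrec a (- z) w (Suc i) + x * lrec a (- z) w i = lrec a (- x) y (Suc i) * w + lrec a (- x) y i * z"
proof (induction i rule: pseq.induct[of _ a])
  case (3 a i)
  have "y * lrec a (- z) w (Suc (Suc (Suc i))) + x * lrec a (- z) w (Suc (Suc i)) =
      a * (y * lrec a (- z) w (Suc (Suc i)) + x * lrec a (- z) w (Suc i)) -
      (y * lrec a (- z) w (Suc i) + x * lrec a (- z) w i)" by (simp add: algebra_simps)
  then show ?case unfolding 3 by (simp add: algebra_simps)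
qed (auto simp: algebra_simps)

definition alt :: "nat \<Rightarrow> nat" where
  "alt m = (if even m then 1 else 2)"

primrec zig :: "quiver \<Rightarrow> nat \<Rightarrow> quiver" where
  "zig X 0 = X"
| "zig X (Suc m) = mutate (alt m) (zig X m)"

lemma alt_uv: "alt m = 1 \<and> alt (Suc m) = 2 \<or> alt m = 2 \<and> alt (Suc m) = 1"
  by (simp add: alt_def)

lemma alt_Suc_Suc: "alt (Suc (Suc m)) = alt m"
  by (simp add: alt_def)

locale long_cycle_data =
  fixes n k :: nat and q :: "nat \<Rightarrow> nat \<Rightarrow> int" and Q :: quiver
  assumes n: "4 \<le> n" and k: "1 \<le> k"
    and q: "\<And>i j. 1 \<le> i \<Longrightarrow> i < j \<Longrightarrow> j \<le> n \<Longrightarrow> 2 \<le> q i j"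
    and Q: "Q = long_cycle_quiver n k q"
begin

abbreviation "a \<equiv> q 1 2"

text \<open>The index of \<open>c\<close> counts the mutations left until the far end of a line, so
  \<open>c\<close> is run through downwards, while \<open>d\<close> is run through upwards.\<close>

definition c :: "nat \<Rightarrow> nat \<Rightarrow> int" where
  "c j = lrec a (- q 1 j) (q 2 j)"

definition d :: "nat \<Rightarrow> int" where
  "d = lrec a (- q 2 n) (q 1 n)"

lemma a: "2 \<le> a" and q1n: "2 \<le> q 1 n" and q2n: "2 \<le> q 2 n"
  using n by (auto intro!: q)

lemma q1: "3 \<le> j \<Longrightarrow> j < n \<Longrightarrow> 2 \<le> q 1 j" and q2: "3 \<le> j \<Longrightarrow> j < n \<Longrightarrow> 2 \<le> q 2 j"
  and qn: "3 \<le> j \<Longrightarrow> j < n \<Longrightarrow> 2 \<le> q j n"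
  by (auto intro!: q)

lemma c_rec: "c j (Suc (Suc i)) = a * c j (Suc i) - c j i" and c_0: "c j 0 = - q 1 j" and c_1: "c j (Suc 0) = q 2 j"
  by (simp_all add: c_def)

lemma d_rec: "d (Suc (Suc i)) = a * d (Suc i) - d i" and d_0: "d 0 = - q 2 n" and d_1: "d (Suc 0) = q 1 n"
  by (simp_all add: d_def)

lemma c_ge2: "3 \<le> j \<Longrightarrow> j < n \<Longrightarrow> 1 \<le> i \<Longrightarrow> 2 \<le> c j i"
  unfolding c_def using a q1[of j] q2[of j] by (intro lrec_ge2) auto

lemma c_less: "3 \<le> j \<Longrightarrow> j < n \<Longrightarrow> i < i' \<Longrightarrow> c j i < c j i'"
  unfolding c_def using a q1[of j] q2[of j] by (intro lrec_less) auto

lemma c_gt: "3 \<le> j \<Longrightarrow> j < n \<Longrightarrow> 2 \<le> i \<Longrightarrow> a < c j i"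
  unfolding c_def using a q1[of j] q2[of j] by (intro lrec_gt) auto

lemma d_ge2: "1 \<le> i \<Longrightarrow> 2 \<le> d i"
  unfolding d_def using a q1n q2n by (intro lrec_ge2) auto

lemma d_gt: "2 \<le> i \<Longrightarrow> a < d i"
  unfolding d_def using a q1n q2n by (intro lrec_gt) auto

lemma Q_shape: "strip_shape n q 1 2 a (\<lambda>j. c j (2 * k)) (\<lambda>j. c j (Suc (2 * k)))
    (- q 1 n) (q 2 n) (\<lambda>j. q j n) Q"
proof -
  define m where "m = k - 1"
  have k': "k = Suc m" using k by (simp add: m_def)
  have qu: "is_quiver n Q" unfolding is_quiver_def Q long_cycle_quiver_def by auto
  have c': "c j (2 * k) = pseq a (2 * k - 2) * q 1 j + pseq a (2 * k - 1) * q 2 j"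
    "c j (Suc (2 * k)) = pseq a (2 * k - 1) * q 1 j + pseq a (2 * k) * q 2 j" for j
    unfolding c_def k' using lrec_pseq[of a "q 1 j" "q 2 j" "2 * m"] lrec_pseq[of a "q 1 j" "q 2 j" "2 * m + 1"]
    by (simp_all del: lrec.simps(3) pseq.simps(3))
  show ?thesis
    unfolding strip_shape_def c' using n
    by (auto simp: qu Q[THEN fun_cong, THEN fun_cong] long_cycle_quiver_def upper_entry_def Let_def)
qed

text \<open>The vertex n is a sink of \<open>Q\<close>, so this mutation only reverses its
  arrows.\<close>

lemma mutate_n_Q_shape: "strip_shape n q 1 2 a (\<lambda>j. c j (2 * k)) (\<lambda>j. c j (Suc (2 * k)))
    (d 1) (d 0) (\<lambda>j. - q j n) (mutate n Q)"
proof -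
  note e = strip_shape_entries[OF Q_shape]
  have qu: "is_quiver n (mutate n Q)"
    using Q_shape by (auto simp: strip_shape_def intro: is_quiver_mutate)
  have pos: "0 < q 1 n" "0 < q 2 n" "\<not> q 1 n < 0" "\<not> q 2 n < 0" using q1n q2n by auto
  have D: "0 < q j n" "\<not> q j n < 0" if "3 \<le> j" "j < n" for j using qn[OF that] by auto
  show ?thesis
    unfolding strip_shape_def using n
    by (auto simp: qu mutate_eq e pos D d_0 d_1[simplified] simp del: One_nat_def) (auto simp: d_1)
qed

text \<open>On the line through \<open>Q\<close> the entry \<open>R\<close> is negative for the
  first two mutations. These give no path from n to \<open>v\<close>, so the recurrence
  \<open>d\<close> starts two steps late; they alone change the arrows between middle vertices and
  n, whence the two summands in \<open>D1\<close>.\<close>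

definition R1 :: "nat \<Rightarrow> int" where
  "R1 m = (if m = 0 then - q 1 n else if m = 1 then - q 2 n else d (m - 1))"

definition S1 :: "nat \<Rightarrow> int" where
  "S1 m = (if m = 0 then q 2 n else if m = 1 then - q 1 n else d (m - 2))"

definition D1 :: "nat \<Rightarrow> nat \<Rightarrow> int" where
  "D1 m j = q j n + (if 1 \<le> m then c j (2 * k) * q 1 n else 0) + (if 2 \<le> m then c j (2 * k - 1) * q 2 n else 0)"

lemma shape1:
  "m \<le> 2 * k \<Longrightarrow> strip_shape n q (alt m) (alt (Suc m)) a (\<lambda>j. c j (2 * k - m)) (\<lambda>j. c j (Suc (2 * k) - m))
     (R1 m) (S1 m) (D1 m) (zig Q m)"
proof (induction m)
  case 0
  then show ?case using Q_shape by (simp add: alt_def R1_def S1_def D1_def[abs_def])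
next
  case (Suc m)
  define r where "r = 2 * k - Suc m"
  have r: "2 * k - m = Suc r" "2 * k - Suc m = r" "Suc (2 * k) - m = Suc (Suc r)" "Suc (2 * k) - Suc m = Suc r"
    using Suc.prems by (auto simp: r_def)
  have pos: "0 < c j (Suc r)" if "3 \<le> j" "j < n" for j using c_ge2[OF that, of "Suc r"] by simp
  have sh: "strip_shape n q (alt m) (alt (Suc m)) a (\<lambda>j. c j (Suc r)) (\<lambda>j. c j (Suc (Suc r)))
     (R1 m) (S1 m) (D1 m) (zig Q m)" using Suc unfolding r by simp
  have cc: "(\<lambda>j. a * c j (Suc r) - c j (Suc (Suc r))) = (\<lambda>j. c j r)" by (simp add: c_rec)
  have RSD: "a * max (R1 m) 0 - S1 m = R1 (Suc m) \<and> R1 m = S1 (Suc m) \<and>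
      (\<forall>j. D1 m j + c j (Suc r) * max (- R1 m) 0 = D1 (Suc m) j)"
  proof -
    consider "m = 0" | "m = 1" | l where "m = Suc (Suc l)" by (metis One_nat_def not0_implies_Suc)
    then show ?thesis
    proof cases
      case 1
      then show ?thesis using q1n r by (auto simp: R1_def S1_def D1_def)
    next
      case 2
      then have "2 * k - Suc 0 = Suc r" using r by simp
      with 2 show ?thesis using q1n q2n by (auto simp: R1_def S1_def D1_def d_0 d_1)
    next
      case 3
      then show ?thesis using d_ge2[of "Suc l"] by (auto simp: R1_def S1_def D1_def d_rec)
    qed
  qed
  then have D1: "(\<lambda>j. D1 m j + c j (Suc r) * max (- R1 m) 0) = D1 (Suc m)" by blast
  have "0 < a" using a by simp
  from strip_shape_mutate[OF n alt_uv sh this pos]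
  have "strip_shape n q (alt (Suc m)) (alt m) a (\<lambda>j. c j r) (\<lambda>j. c j (Suc r))
     (R1 (Suc m)) (R1 m) (D1 (Suc m)) (mutate (alt m) (zig Q m))"
    unfolding cc D1 RSD[THEN conjunct1] .
  moreover have "S1 (Suc m) = R1 m" using RSD by simp
  ultimately show ?case unfolding r alt_Suc_Suc zig.simps by (simp only:)
qed

text \<open>On this line \<open>R\<close> is positive before every mutation, so the recurrence
  \<open>d\<close> runs from the start and the arrows between middle vertices and n never
  change.\<close>

lemma shape2:
  "m \<le> 2 * k \<Longrightarrow> strip_shape n q (alt m) (alt (Suc m)) a (\<lambda>j. c j (2 * k - m)) (\<lambda>j. c j (Suc (2 * k) - m))
     (d (Suc m)) (d m) (\<lambda>j. - q j n) (zig (mutate n Q) m)"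
proof (induction m)
  case 0
  then show ?case using mutate_n_Q_shape by (simp add: alt_def)
next
  case (Suc m)
  define r where "r = 2 * k - Suc m"
  have r: "2 * k - m = Suc r" "2 * k - Suc m = r" "Suc (2 * k) - m = Suc (Suc r)" "Suc (2 * k) - Suc m = Suc r"
    using Suc.prems by (auto simp: r_def)
  have pos: "0 < c j (Suc r)" if "3 \<le> j" "j < n" for j using c_ge2[OF that, of "Suc r"] by simp
  have "strip_shape n q (alt m) (alt (Suc m)) a (\<lambda>j. c j (Suc r)) (\<lambda>j. c j (Suc (Suc r)))
     (d (Suc m)) (d m) (\<lambda>j. - q j n) (zig (mutate n Q) m)" using Suc unfolding r by simp
  from strip_shape_mutate[OF n alt_uv this _ pos]
  show ?case unfolding r alt_Suc_Suc using a d_ge2[of "Suc m"] by (simp add: c_rec d_rec)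
qed

lemma R1_S1_Suc: "R1 0 = - q 1 n" "S1 0 = q 2 n" "R1 (Suc 0) = - q 2 n" "S1 (Suc 0) = - q 1 n"
  "R1 (Suc (Suc m)) = d (Suc m)" "S1 (Suc (Suc m)) = d m"
  by (simp_all add: R1_def S1_def)

lemma R1_S1_ge2: "2 \<le> \<bar>R1 m\<bar>" "2 \<le> \<bar>S1 m\<bar>"
proof -
  have "2 \<le> \<bar>d i\<bar>" for i using d_ge2[of i] d_0 q2n by (cases i) auto
  moreover have "2 \<le> \<bar>q 1 n\<bar>" "2 \<le> \<bar>q 2 n\<bar>" using q1n q2n by linarith+
  moreover obtain l where "m = 0 \<or> m = Suc 0 \<or> m = Suc (Suc l)" by (metis not0_implies_Suc)
  ultimately show "2 \<le> \<bar>R1 m\<bar>" "2 \<le> \<bar>S1 m\<bar>"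
    by (elim disjE; simp only: R1_S1_Suc abs_minus_cancel)+
qed

lemma D1_bounds:
  assumes j: "3 \<le> j" "j < n"
  shows "2 \<le> D1 m j" "1 \<le> m \<Longrightarrow> q 1 n < D1 m j" "1 \<le> m \<Longrightarrow> c j (2 * k) < D1 m j"
    "2 \<le> m \<Longrightarrow> q 2 n < D1 m j" "2 \<le> m \<Longrightarrow> c j (2 * k - 1) < D1 m j"
proof -
  have c2: "2 \<le> c j (2 * k)" "2 \<le> c j (2 * k - 1)" using c_ge2[OF j] k by auto
  have prod: "x < x * y" "y < x * y" if "2 \<le> x" "2 \<le> y" for x y :: int
    using mult_gt_max_plus[OF that, of 0] that by auto
  note p = prod[OF c2(1) q1n] prod[OF c2(2) q2n]
  show "2 \<le> D1 m j" "1 \<le> m \<Longrightarrow> q 1 n < D1 m j" "1 \<le> m \<Longrightarrow> c j (2 * k) < D1 m j"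
    "2 \<le> m \<Longrightarrow> q 2 n < D1 m j" "2 \<le> m \<Longrightarrow> c j (2 * k - 1) < D1 m j"
    using p c2 q1n q2n qn[OF j] unfolding D1_def by (smt (verit))+
qed

lemma strip1:
  assumes "m < 2 * k"
  shows "strip n q (alt m) (alt (Suc m)) a (\<lambda>j. c j (2 * k - m)) (\<lambda>j. c j (Suc (2 * k) - m))
     (R1 m) (S1 m) (D1 m) (zig Q m)"
proof
  show "2 \<le> \<bar>R1 m\<bar>" "2 \<le> \<bar>S1 m\<bar>" by (rule R1_S1_ge2)+
  fix j assume j: "3 \<le> j" "j < n"
  then show "2 \<le> \<bar>D1 m j\<bar>" using D1_bounds(1)[OF j, of m] by simp
  show "2 \<le> c j (2 * k - m)" "2 \<le> c j (Suc (2 * k) - m)"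
    using c_ge2[OF j, of "2 * k - m"] c_ge2[OF j, of "Suc (2 * k) - m"] assms by auto
next
  show "2 \<le> q i j" if "3 \<le> i" "i < j" "j < n" for i j using that by (intro q) auto
qed (use assms n a alt_uv[of m] shape1[of m] in \<open>simp_all del: One_nat_def\<close>)

lemma strip2:
  assumes "m < 2 * k"
  shows "strip n q (alt m) (alt (Suc m)) a (\<lambda>j. c j (2 * k - m)) (\<lambda>j. c j (Suc (2 * k) - m))
     (d (Suc m)) (d m) (\<lambda>j. - q j n) (zig (mutate n Q) m)"
proof
  show "2 \<le> \<bar>d (Suc m)\<bar>" "2 \<le> \<bar>d m\<bar>"
    using q1n q2n d_ge2[of m] d_ge2[of "Suc m"] d_0 by (cases m; simp)+
  fix j assume j: "3 \<le> j" "j < n"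
  then show "2 \<le> \<bar>- q j n\<bar>" using qn[OF j] by auto
  show "2 \<le> c j (2 * k - m)" "2 \<le> c j (Suc (2 * k) - m)"
    using c_ge2[OF j, of "2 * k - m"] c_ge2[OF j, of "Suc (2 * k) - m"] assms by auto
next
  show "2 \<le> q i j" if "3 \<le> i" "i < j" "j < n" for i j using that by (intro q) auto
qed (use assms n a alt_uv[of m] shape2[of m] in \<open>simp_all del: One_nat_def\<close>)

text \<open>Leaving either of the two lines of alternating mutations before its last quiver, other than
  by going on or back, leads to a fork.\<close>

lemma exit1:
  assumes m: "m < 2 * k" and x: "x \<in> {1..n}" "x \<noteq> alt m" "x \<noteq> (if m = 0 then n else alt (Suc m))"
  shows "fork n (mutate x (zig Q m)) x"
proof (rule fork_mutate)
  interpret strip n q "alt m" "alt (Suc m)" a "\<lambda>j. c j (2 * k - m)" "\<lambda>j. c j (Suc (2 * k) - m)"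
    "R1 m" "S1 m" "D1 m" "zig Q m" using m by (rule strip1)
  have D: "0 < D1 m j" if "3 \<le> j" "j < n" for j using D1_bounds(1)[OF that, of m] by simp
  obtain l where ml: "m = 0 \<or> m = Suc 0 \<or> m = Suc (Suc 0) \<or> m = Suc (Suc (Suc l))"
    by (metis not0_implies_Suc)
  have "x = alt (Suc m) \<or> x = n \<or> 3 \<le> x \<and> x < n" using x alt_uv[of m] by auto
  \<comment> \<open>For x = n the signs decide: at m = 1 both \<open>R1\<close> and
    \<open>S1\<close> are negative, at m = 2 only \<open>S1\<close> is, and from m = 3 on both are
    positive with \<open>R1\<close> above \<open>a\<close>.\<close>
  then consider "3 \<le> x" "x < n" | "m = 0" "x = alt (Suc m)" | "x = n" "m = Suc 0"
    | "x = n" "m = Suc (Suc 0)" | "x = n" "m = Suc (Suc (Suc l))"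
    using ml x(3) by (auto split: if_splits)
  then show "fork_maker n (zig Q m) x"
  proof cases
    case 1
    have "- S1 m < D1 m x"
      using ml D[OF 1] D1_bounds(2,4)[OF 1, of m] q2n d_ge2[of "Suc l"] d_0
      by (elim disjE) (simp_all only: R1_S1_Suc, simp_all)
    moreover have "a < c x (Suc (2 * k) - m)" using m by (intro c_gt 1) simp
    ultimately show ?thesis using 1 D by (intro fork_maker_middle_pos)
  next
    case 2
    then show ?thesis unfolding 2(2)
      using q1n q2n D c_less by (intro fork_maker_target_pos) (simp_all add: R1_def S1_def)
  next
    case 3
    then show ?thesis unfolding \<open>x = n\<close>
      using q1n q2n D D1_bounds(3)[of _ m] by (intro fork_maker_last_out) (simp_all add: R1_def S1_def)
  next
    case 4
    then show ?thesis unfolding \<open>x = n\<close>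
      using q2n d_0 d_ge2[of 1] D D1_bounds(5)[of _ m]
      by (intro fork_maker_last_in) (simp_all add: R1_def S1_def)
  next
    case 5
    then show ?thesis unfolding \<open>x = n\<close>
      using d_gt[of "Suc (Suc l)"] d_ge2[of "Suc l"] d_ge2[of "Suc (Suc l)"] D
      by (intro fork_maker_last_pos) (simp_all only: R1_S1_Suc, simp_all)
  qed
qed

lemma exit2:
  assumes m: "m < 2 * k" and x: "x \<in> {1..n}" "x \<noteq> alt m" "x \<noteq> (if m = 0 then n else alt (Suc m))"
  shows "fork n (mutate x (zig (mutate n Q) m)) x"
proof (rule fork_mutate)
  interpret strip n q "alt m" "alt (Suc m)" a "\<lambda>j. c j (2 * k - m)" "\<lambda>j. c j (Suc (2 * k) - m)"
    "d (Suc m)" "d m" "\<lambda>j. - q j n" "zig (mutate n Q) m" using m by (rule strip2)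
  have D: "- q j n < 0" if "3 \<le> j" "j < n" for j using qn[OF that] by simp
  have d_pos: "0 < d (Suc m)" using d_ge2[of "Suc m"] by simp
  have "x = alt (Suc m) \<or> x = n \<or> 3 \<le> x \<and> x < n" using x alt_uv[of m] by auto
  then consider "3 \<le> x" "x < n" | "m = 0" "x = alt (Suc m)" | "x = n" "1 \<le> m"
    using x(3) by (cases "m = 0") auto
  then show "fork_maker n (zig (mutate n Q) m) x"
  proof cases
    case 1
    have "a < c x (Suc (2 * k) - m)" using m by (intro c_gt 1) simp
    then show ?thesis using 1 D d_pos by (intro fork_maker_middle_neg)
  next
    case 2
    then show ?thesis unfolding 2(2)
      using d_pos d_0 q2n D c_less by (intro fork_maker_target_neg) simp_all
  next
    case 3
    then show ?thesis unfolding \<open>x = n\<close>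
      using d_gt[of "Suc m"] d_ge2[of m] d_pos D
      by (intro fork_maker_last_neg) simp_all
  qed
qed

text \<open>The arrows between 3 and n point to n on the line through \<open>Q\<close> and to 3 on
  the other one.\<close>

lemma zig_ne:
  assumes "m \<le> 2 * k" "m' \<le> 2 * k"
  shows "zig Q m \<noteq> zig (mutate n Q) m'"
proof -
  have "zig Q m 3 n = D1 m 3" "zig (mutate n Q) m' 3 n = - q 3 n"
    using shape1[OF assms(1)] shape2[OF assms(2)] n by (simp_all add: strip_shape_def)
  then show ?thesis using D1_bounds(1)[of 3 m] qn[of 3] n by auto
qed

lemma no_short_loop:
  assumes rl: "reduced_loop n N l s" and s0: "s 0 = Q" and l0: "l 0 = n" and N: "N \<le> 4 * int k"
  shows False
proof -
  have st: "l j \<in> {1..n}" "s (j + 1) = mutate (l j) (s j)" "l j \<noteq> l (j + 1)" "s (j + N) = s j" for j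
    using rl by (auto simp: reduced_loop_def)
  note nf = reduced_loop_no_fork[OF rl]
  have forced1: "m \<le> 2 * k \<Longrightarrow> s (- int m) = zig Q m \<and> l (- int m) = (if m = 0 then n else alt (Suc m))" for m
  proof (induction m)
    case 0
    then show ?case using s0 l0 by simp
  next
    case (Suc m)
    let ?x = "l (- int m - 1)"
    have z: "s (- int m - 1) = mutate ?x (zig Q m)"
      using st(2)[of "- int m - 1"] Suc by simp
    have "?x \<noteq> l (- int m)" using st(3)[of "- int m - 1"] by simp
    then have "?x = alt m"
      using exit1[of m ?x] nf[of "- int m - 1"] st(1) Suc unfolding z by fastforce
    moreover have "- int (Suc m) = - int m - 1" by simp
    ultimately show ?case using z by (simp only: alt_Suc_Suc) simp
  qed
  have forced2: "m \<le> 2 * k \<Longrightarrow> s (int m + 1) = zig (mutate n Q) m \<and> l (int m) = (if m = 0 then n else alt (Suc m))" for m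
  proof (induction m)
    case 0
    then show ?case using s0 l0 st(2)[of 0] by simp
  next
    case (Suc m)
    let ?x = "l (int m + 1)"
    have z: "s (int m + 1 + 1) = mutate ?x (zig (mutate n Q) m)"
      using st(2)[of "int m + 1"] Suc by simp
    have "?x \<noteq> l (int m)" using st(3)[of "int m"] by simp
    then have "?x = alt m"
      using exit2[of m ?x] nf[of "int m + 1 + 1"] st(1) Suc unfolding z by fastforce
    then show ?case using z by (simp add: alt_Suc_Suc algebra_simps)
  qed
  have N0: "0 < N" using rl by (simp add: reduced_loop_def)
  \<comment> \<open>The N - 1 steps besides the edge are split into \<open>f\<close> forward and
    \<open>g\<close> backward ones, both within the forced range; by periodicity they end at the
    same quiver.\<close>
  define f where "f = min (2 * k) (nat (N - 1))"
  define g where "g = nat (N - 1) - f"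
  have fg: "f \<le> 2 * k" "g \<le> 2 * k" "int f + 1 = - int g + N"
    using N N0 by (auto simp: f_def g_def)
  then show False
    using forced1[of g] forced2[of f] st(4)[of "- int g"] zig_ne[of g f] by simp
qed

lemma edge_avoided:
  assumes "(C, ks) \<in> cells n (4 * k) Q" and j: "j < length ks" "ks ! j = n"
  shows "mutate_list (take j ks) C \<notin> {Q, mutate n Q}"
proof
  define N where "N = int (length ks)"
  define l where "l = (\<lambda>i. ks ! nat (i mod N))"
  define s where "s = (\<lambda>i. mutate_list (take (nat (i mod N)) ks) C)"
  have "mutation_cycle n C ks" and N: "N \<le> 4 * int k"
    using assms(1) by (auto simp: cells_def N_def)
  then have rl: "reduced_loop n N l s"
    unfolding N_def l_def s_def by (intro reduced_loop_mutation_cycle)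
  have lj: "l (int j) = n" and sj: "s (int j) = mutate_list (take j ks) C"
    using j by (simp_all add: l_def s_def N_def)
  assume "mutate_list (take j ks) C \<in> {Q, mutate n Q}"
  then consider "s (int j) = Q" | "s (int j) = mutate n Q" using sj by auto
  then show False
  proof cases
    case 1
    show False
      using no_short_loop[OF reduced_loop_shift[OF rl, of "int j"] _ _ N] 1 lj by simp
  next
    case 2
    \<comment> \<open>The edge is traversed towards \<open>Q\<close>; the reversed walk leaves
      \<open>Q\<close> along it.\<close>
    have "s (int j + 1) = mutate (l (int j)) (s (int j))" using rl by (simp add: reduced_loop_def)
    then have "s (int j + 1) = Q" using 2 lj by simp
    then show False
      using no_short_loop[OF reduced_loop_reverse[OF reduced_loop_shift[OF rl, of "int j + 1"]] _ _ N] lj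
      by simp
  qed
qed

end

section \<open>The long cycle\<close>

lemma mutate_sink:
  assumes "is_quiver n X" "\<And>j. X x j \<le> 0"
  shows "mutate x X i j = (if i = x \<or> j = x then - X i j else X i j)"
proof -
  have "\<not> X i x < 0" "\<not> 0 < X x j" using assms(2)[of i] assms(2)[of j] is_quiver_skew[OF assms(1), of x i] by auto
  then show ?thesis by (simp add: mutate_eq)
qed

lemma zig_eq_mutate_list: "zig X m = mutate_list (map alt [0..<m]) X"
  by (induction m) auto

lemma mutate_list_rev_upt_zig:
  "m \<le> m' \<Longrightarrow> mutate_list (map alt (rev [m..<m'])) (zig X m') = zig X m"
proof (induction m rule: inc_induct)
  case (step m)
  then have "[m..<m'] = m # [Suc m..<m']" by (simp add: upt_conv_Cons)
  then show ?case using step by simp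
qed simp

lemma concat_replicate_Suc: "concat (replicate (Suc k) xs) = concat (replicate k xs) @ xs"
  by (induction k) auto

lemma concat_replicate_alt: "concat (replicate k [1, 2]) = map alt [0..<2 * k]"
proof (induction k)
  case (Suc k)
  show ?case unfolding concat_replicate_Suc Suc by (simp add: alt_def)
qed simp

lemma concat_replicate_alt_rev: "concat (replicate k [2, 1]) = map alt (rev [0..<2 * k])"
proof -
  have "concat (replicate k [2, 1]) = rev (concat (replicate k [1, 2 :: nat]))"
    by (simp add: rev_concat map_replicate)
  then show ?thesis unfolding concat_replicate_alt by (simp only: rev_map)
qed

lemma long_cycle_eq:
  "long_cycle n k = n # map alt [0..<2 * k] @ rev [1..<n] @ map alt (rev [0..<2 * k])"
  by (simp add: long_cycle_def concat_replicate_alt concat_replicate_alt_rev del: One_nat_def)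

section \<open>Closing the cycle: from one far end to the other\<close>

context long_cycle_data
begin

definition descent :: "nat \<Rightarrow> quiver" where
  "descent t = mutate_list (rev [t..<n]) (zig (mutate n Q) (2 * k))"

lemma descent_n: "descent n = zig (mutate n Q) (2 * k)"
  by (simp add: descent_def)

lemma descent_step: "t < n \<Longrightarrow> descent t = mutate t (descent (Suc t))"
  unfolding descent_def by (simp add: upt_conv_Cons)

text \<open>The state after mutating at n - 1, ..., t: an arrow with a middle endpoint is reversed
  exactly when one of its ends, but not the other, is among t, ..., n - 1.\<close>

definition descent_shape :: "nat \<Rightarrow> quiver \<Rightarrow> bool" where
  "descent_shape t X \<longleftrightarrow> is_quiver n X \<and> X 1 2 = a \<and> X n 1 = d (Suc (2 * k)) \<and> X 2 n = d (2 * k) \<and>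
     (\<forall>j. 3 \<le> j \<and> j < n \<longrightarrow> X 1 j = (if t \<le> j then - q 1 j else q 1 j) \<and>
        X 2 j = (if t \<le> j then - q 2 j else q 2 j) \<and> X j n = (if t \<le> j then q j n else - q j n)) \<and>
     (\<forall>i j. 3 \<le> i \<and> i < j \<and> j < n \<longrightarrow> X i j = (if i < t \<and> t \<le> j then - q i j else q i j))"

lemma descent_shape_n: "descent_shape n (descent n)"
proof -
  have "alt (2 * k) = 1" "alt (Suc (2 * k)) = 2" by (simp_all add: alt_def)
  then have sh: "strip_shape n q 1 2 a (\<lambda>j. - q 1 j) (\<lambda>j. q 2 j)
     (d (Suc (2 * k))) (d (2 * k)) (\<lambda>j. - q j n) (descent n)"
    using shape2[of "2 * k"] by (simp add: c_0 c_1 descent_n Suc_diff_le)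
  note e = strip_shape_entries[OF sh]
  have "is_quiver n (descent n)" using sh by (simp add: strip_shape_def)
  then show ?thesis unfolding descent_shape_def using n by (auto simp: e simp del: One_nat_def)
qed

text \<open>When its turn comes, \<open>x\<close> is a sink: the larger middle vertices already
  point to it, and 1, 2, n and the smaller ones do so from the start.\<close>

lemma descent_shape_step:
  assumes sh: "descent_shape (Suc x) X" and x: "3 \<le> x" "x < n"
  shows "descent_shape x (mutate x X)"
proof -
  have qu: "is_quiver n X" using sh by (simp add: descent_shape_def)
  note sk = is_quiver_skew[OF qu]
  have e: "X 1 2 = a" "X n 1 = d (Suc (2 * k))" "X 2 n = d (2 * k)"
    "\<And>j. 3 \<le> j \<Longrightarrow> j < n \<Longrightarrow> X 1 j = (if Suc x \<le> j then - q 1 j else q 1 j)"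
    "\<And>j. 3 \<le> j \<Longrightarrow> j < n \<Longrightarrow> X 2 j = (if Suc x \<le> j then - q 2 j else q 2 j)"
    "\<And>j. 3 \<le> j \<Longrightarrow> j < n \<Longrightarrow> X j n = (if Suc x \<le> j then q j n else - q j n)"
    "\<And>i j. 3 \<le> i \<Longrightarrow> i < j \<Longrightarrow> j < n \<Longrightarrow> X i j = (if i < Suc x \<and> Suc x \<le> j then - q i j else q i j)"
    using sh unfolding descent_shape_def by blast+
  have "X x j \<le> 0" for j
  proof (cases "j \<in> {1..n}")
    case True
    then consider "j = 1" | "j = 2" | "j = n" | "3 \<le> j" "j < x" | "j = x" | "x < j" "j < n" by force
    then show ?thesis
    proof cases
      case 1
      then show ?thesis using sk[of 1 x] e(4)[OF x] q1[OF x] by simp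
    next
      case 2
      then show ?thesis using sk[of 2 x] e(5)[OF x] q2[OF x] by simp
    next
      case 3
      then show ?thesis using e(6)[OF x] qn[OF x] by simp
    next
      case 4
      then show ?thesis using sk[of j x] e(7)[of j x] x q[of j x] by simp
    next
      case 5
      then show ?thesis using is_quiver_diag[OF qu] by simp
    next
      case 6
      then show ?thesis using e(7)[of x j] x q[of x j] by simp
    qed
  qed (use is_quiver_outside[OF qu] in simp)
  note ms = mutate_sink[OF qu this]
  have qu': "is_quiver n (mutate x X)" using qu by (rule is_quiver_mutate)
  show ?thesis
    unfolding descent_shape_def
  proof (intro conjI allI impI qu'; (elim conjE)?)
    show "mutate x X 1 2 = a" "mutate x X n 1 = d (Suc (2 * k))" "mutate x X 2 n = d (2 * k)"
      using x by (simp_all add: ms e del: One_nat_def)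
    fix j assume j: "3 \<le> j" "j < n"
    show "mutate x X 1 j = (if x \<le> j then - q 1 j else q 1 j)"
      "mutate x X 2 j = (if x \<le> j then - q 2 j else q 2 j)"
      "mutate x X j n = (if x \<le> j then q j n else - q j n)"
      using x e(4-6)[OF j] by (auto simp: ms simp del: One_nat_def)
  next
    fix i j assume ij: "3 \<le> i" "i < j" "j < n"
    show "mutate x X i j = (if i < x \<and> x \<le> j then - q i j else q i j)"
      using e(7)[OF ij] ij by (auto simp: ms)
  qed
qed

lemma descent_shape: "3 \<le> t \<Longrightarrow> t \<le> n \<Longrightarrow> descent_shape t (descent t)"
proof (induction t rule: measure_induct_rule[where f = "\<lambda>t. n - t"])
  case (less t)
  show ?case
  proof (cases "t = n")
    case True
    then show ?thesis using descent_shape_n by simp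
  next
    case False
    then have "descent_shape (Suc t) (descent (Suc t))" using less by simp
    then show ?thesis using descent_shape_step less.prems False descent_step by simp
  qed
qed

lemma d_signs: "0 < d (Suc (2 * k))" "0 < d (2 * k)" "0 < d (2 * k - 1)"
  "\<not> d (Suc (2 * k)) < 0" "\<not> d (2 * k) < 0" "\<not> d (2 * k - 1) < 0"
proof -
  have "2 \<le> d (Suc (2 * k))" "2 \<le> d (2 * k)" "2 \<le> d (2 * k - 1)" using k by (auto intro!: d_ge2)
  then show "0 < d (Suc (2 * k))" "0 < d (2 * k)" "0 < d (2 * k - 1)"
    "\<not> d (Suc (2 * k)) < 0" "\<not> d (2 * k) < 0" "\<not> d (2 * k - 1) < 0" by linarith+
qed

lemma descent_3_shape:
  "strip_shape n q 1 2 a (\<lambda>j. q 1 j) (\<lambda>j. - q 2 j) (d (Suc (2 * k))) (d (2 * k)) (\<lambda>j. q j n) (descent 3)"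
proof -
  have sh: "descent_shape 3 (descent 3)" using n by (intro descent_shape) auto
  then have qu: "is_quiver n (descent 3)" by (simp add: descent_shape_def)
  have "descent 3 j 1 = q 1 j" if "3 \<le> j" "j < n" for j
    using sh that is_quiver_skew[OF qu, of 1 j] by (simp add: descent_shape_def)
  then show ?thesis using sh by (simp add: strip_shape_def descent_shape_def)
qed

text \<open>Here 2 is not a sink: paths j -> 2 -> n add arrows j -> n, and 1 -> 2 -> n runs the
  recurrence for \<open>d\<close> two indices back, from 2k + 1 to 2k - 1.\<close>

lemma descent_2_shape:
  "strip_shape n q 1 2 (- a) (\<lambda>j. q 1 j) (\<lambda>j. q 2 j) (- d (2 * k - 1)) (- d (2 * k))
     (\<lambda>j. q j n + q 2 j * d (2 * k)) (descent 2)"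
proof -
  note e = strip_shape_entries[OF descent_3_shape]
  have qu: "is_quiver n (descent 3)" using descent_3_shape by (simp add: strip_shape_def)
  have d2: "descent 2 = mutate 2 (descent 3)" using descent_step[of 2] n by (simp add: numeral_3_eq_3)
  have pos: "0 < q 2 j" "\<not> q 2 j < 0" if "3 \<le> j" "j < n" for j using q2[OF that] by auto
  have "d (Suc (2 * k)) = a * d (2 * k) - d (2 * k - 1)"
    using d_rec[of "2 * k - 1"] k by (cases k) simp_all
  then show ?thesis
    unfolding strip_shape_def d2 using n a
    by (auto simp: is_quiver_mutate[OF qu] mutate_eq e pos d_signs simp del: One_nat_def)
qed

text \<open>The mutation at 1 lowers an index of \<open>d\<close> once more. The arrows j -> n,
  collected here with coefficients from \<open>d\<close> and on the line through \<open>Q\<close>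
  with coefficients from \<open>c\<close>, agree by \<open>lrec_exchange\<close>.\<close>

lemma descent_1: "descent 1 = zig Q (2 * k)"
proof -
  note e = strip_shape_entries[OF descent_2_shape]
  have qu: "is_quiver n (descent 2)" using descent_2_shape by (simp add: strip_shape_def)
  have d1: "descent 1 = mutate 1 (descent 2)" using descent_step[of 1] n by (simp add: numeral_2_eq_2)
  have pos: "0 < q 1 j" "\<not> q 1 j < 0" if "3 \<le> j" "j < n" for j using q1[OF that] by auto
  have ex: "q 2 j * d (2 * k) + q 1 j * d (2 * k - 1) = c j (2 * k) * q 1 n + c j (2 * k - 1) * q 2 n" for j
    using lrec_exchange[of "q 2 j" a "q 2 n" "q 1 n" "2 * k - 1" "q 1 j"] k by (simp add: c_def d_def)
  have rec: "d (2 * k) = a * d (2 * k - 1) - d (2 * k - 2)"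
    using d_rec[of "2 * k - 2"] k by (cases k) simp_all
  have "strip_shape n q 1 2 a (\<lambda>j. - q 1 j) (\<lambda>j. q 2 j) (d (2 * k - 1)) (d (2 * k - 2))
     (\<lambda>j. q j n + (q 2 j * d (2 * k) + q 1 j * d (2 * k - 1))) (descent 1)"
    unfolding strip_shape_def d1 using n a
    by (auto simp: is_quiver_mutate[OF qu] mutate_eq e pos d_signs rec simp del: One_nat_def)
  moreover have "strip_shape n q 1 2 a (\<lambda>j. - q 1 j) (\<lambda>j. q 2 j) (d (2 * k - 1)) (d (2 * k - 2))
     (\<lambda>j. q j n + (q 2 j * d (2 * k) + q 1 j * d (2 * k - 1))) (zig Q (2 * k))"
    using shape1[of "2 * k"] k unfolding ex
    by (simp add: alt_def c_0 c_1 Suc_diff_le R1_def S1_def D1_def[abs_def] algebra_simps)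
  ultimately show ?thesis using n by (intro strip_shape_unique) auto
qed

text \<open>Signs that tell apart the line through \<open>mutate n Q\<close> (0), the quivers between the two lines
  (1, 2, 3) and the line through \<open>Q\<close> (4).\<close>

definition zone :: "quiver \<Rightarrow> nat" where
  "zone X = (if X 3 n < 0 then (if X (n - 1) n < 0 then 0 else 1)
     else if X 1 3 < 0 \<and> X 2 3 < 0 then 2 else if X 1 3 < 0 \<and> X 1 2 < 0 then 3 else 4)"

lemma zone_zig1:
  assumes "m \<le> 2 * k"
  shows "zone (zig Q m) = 4"
proof -
  note e = strip_shape_entries[OF shape1[OF assms]]
  have D: "\<not> D1 m 3 < 0" using D1_bounds(1)[of 3 m] n by simp
  have "2 \<le> c 3 (Suc (2 * k) - m)" using n assms by (intro c_ge2) auto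
  then have c2: "0 < c 3 (Suc (2 * k) - m)" by simp
  show ?thesis
  proof (cases "m = 2 * k")
    case True
    then show ?thesis
      using e n D q1[of 3] by (simp add: zone_def alt_def c_0)
  next
    case False
    then have "2 \<le> c 3 (2 * k - m)" using n assms by (intro c_ge2) auto
    then have "0 < c 3 (2 * k - m)" by simp
    then show ?thesis
      using e n D c2 a by (cases "even m") (simp_all add: zone_def alt_def)
  qed
qed

lemma zone_zig2:
  assumes "m \<le> 2 * k"
  shows "zone (zig (mutate n Q) m) = 0"
proof -
  have "3 \<le> n - 1" "n - 1 < n" using n by auto
  from strip_shape_entries(14)[OF shape2[OF assms] this] qn[OF this] show ?thesis
    using strip_shape_entries(14)[OF shape2[OF assms], of 3] qn[of 3] n by (simp add: zone_def)
qed

lemma zone_descent: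
  assumes "2 \<le> t" "t < n"
  shows "zone (descent t) = (if t = 2 then 3 else if t = 3 then 2 else 1)"
proof -
  consider "t = 2" | "t = 3" | "4 \<le> t" using assms by linarith
  then show ?thesis
  proof cases
    case 1
    have "0 < q 3 n" "0 < q 2 3" "0 < q 1 3" using qn[of 3] q2[of 3] q1[of 3] n by auto
    moreover from this have "0 < q 2 3 * d (2 * k)" using d_signs by simp
    ultimately show ?thesis
      using 1 n a strip_shape_entries[OF descent_2_shape] by (simp add: zone_def del: One_nat_def)
  next
    case 2
    have "0 < q 3 n" "0 < q 2 3" "0 < q 1 3" using qn[of 3] q2[of 3] q1[of 3] n by auto
    then show ?thesis
      using 2 n strip_shape_entries[OF descent_3_shape] by (simp add: zone_def del: One_nat_def)
  next
    case 3
    have "descent_shape t (descent t)" using 3 assms by (intro descent_shape) auto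
    then have "descent t 3 n = - q 3 n" "descent t (n - 1) n = q (n - 1) n"
      using 3 assms by (auto simp: descent_shape_def)
    moreover have "2 \<le> q 3 n" "2 \<le> q (n - 1) n" using 3 assms by (auto intro!: qn)
    ultimately show ?thesis using 3 by (simp add: zone_def)
  qed
qed

text \<open>Zones 2 and 3 each contain a single quiver of the descent. For 4 \<le> t < t' the arrows
  between t and n are reversed in \<open>descent t\<close> but not yet in
  \<open>descent t'\<close>.\<close>

lemma descent_inj:
  assumes "2 \<le> t" "t < n" "2 \<le> t'" "t' < n" "descent t = descent t'"
  shows "t = t'"
proof -
  have less: False if t: "4 \<le> t" "t < t'" "t' < n" "descent t = descent t'" for t t'
  proof -
    have "descent_shape t (descent t)" "descent_shape t' (descent t')"
      using t(1-3) by (auto intro!: descent_shape)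
    then have "descent t t n = q t n" "descent t' t n = - q t n"
      using t(1-3) by (auto simp: descent_shape_def)
    then show False using t qn[of t] by simp
  qed
  from arg_cong[OF assms(5), of zone] have "t = t' \<or> 4 \<le> t \<and> 4 \<le> t'"
    unfolding zone_descent[OF assms(1,2)] zone_descent[OF assms(3,4)]
    using assms(1-4) by (auto split: if_splits)
  then show ?thesis using less[of t t'] less[of t' t] assms by (cases t t' rule: linorder_cases) auto
qed

text \<open>The total number of arrows between 3 and {1, 2}, which is insensitive to the parity of
  m. The absolute values matter for the negative \<open>c 3 0\<close>.\<close>

definition height :: "nat \<Rightarrow> int" where
  "height i = \<bar>c 3 i\<bar> + \<bar>c 3 (Suc i)\<bar>"

lemma height_less: "i < i' \<Longrightarrow> height i < height i'"
proof (rule lift_Suc_mono_less)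
  fix i
  have "\<bar>c 3 i\<bar> < \<bar>c 3 (Suc (Suc i))\<bar>"
  proof (cases i)
    case 0
    have "0 < a * q 2 3" "0 < q 1 3" using a q2[of 3] q1[of 3] n by auto
    then show ?thesis unfolding 0 c_rec c_0 c_1 by linarith
  next
    case (Suc i')
    then show ?thesis using c_less[of 3 i "Suc (Suc i)"] c_ge2[of 3 i] n by simp
  qed
  then show "height i < height (Suc i)" by (simp add: height_def)
qed

lemma height_zig:
  assumes "strip_shape n q (alt m) (alt (Suc m)) a (\<lambda>j. c j (2 * k - m)) (\<lambda>j. c j (Suc (2 * k) - m)) R S D X"
    and "m \<le> 2 * k"
  shows "\<bar>X 1 3\<bar> + \<bar>X 2 3\<bar> = height (2 * k - m)"
  using strip_shape_entries(11,12)[OF assms(1), of 3] n assms(2)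
  by (cases "even m") (simp_all add: alt_def height_def Suc_diff_le)

lemma zig_inj:
  assumes "m \<le> 2 * k" "m' \<le> 2 * k" "zig Q m = zig Q m' \<or> zig (mutate n Q) m = zig (mutate n Q) m'"
  shows "m = m'"
proof -
  have "height (2 * k - m) = height (2 * k - m')"
    using assms height_zig[OF shape1] height_zig[OF shape2] by metis
  then have "2 * k - m = 2 * k - m'"
    using height_less by (metis less_irrefl linorder_neqE_nat)
  then show ?thesis using assms by simp
qed

text \<open>The first \<open>Suc\<close> accounts for the initial mutation at n. The final block
  undoes the line through \<open>Q\<close> from its far end, so there m counts down to 0.\<close>

lemma mutate_list_long_cycle:
  shows "m \<le> 2 * k \<Longrightarrow> mutate_list (take (Suc m) (long_cycle n k)) Q = zig (mutate n Q) m"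
    and "1 \<le> t \<Longrightarrow> t \<le> n \<Longrightarrow> mutate_list (take (Suc (2 * k + (n - t))) (long_cycle n k)) Q = descent t"
    and "m \<le> 2 * k \<Longrightarrow> mutate_list (take (n + 2 * k + (2 * k - m)) (long_cycle n k)) Q = zig Q m"
proof -
  assume m: "m \<le> 2 * k"
  then show "mutate_list (take (Suc m) (long_cycle n k)) Q = zig (mutate n Q) m"
    by (simp add: long_cycle_eq zig_eq_mutate_list take_map)
  have nn: "n + 2 * k + (2 * k - m) = Suc (2 * k + ((n - 1) + (2 * k - m)))" using n by simp
  have "take (2 * k - m) (rev [0..<2 * k]) = rev [m..<2 * k]" using m by (simp add: take_rev)
  moreover have "mutate_list (rev [1..<n]) (zig (mutate n Q) (2 * k)) = zig Q (2 * k)"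
    using descent_1 by (simp add: descent_def)
  ultimately show "mutate_list (take (n + 2 * k + (2 * k - m)) (long_cycle n k)) Q = zig Q m"
    using m mutate_list_rev_upt_zig[OF m, of Q] unfolding nn
    by (simp add: long_cycle_eq zig_eq_mutate_list[symmetric] take_map)
next
  assume t: "1 \<le> t" "t \<le> n"
  then have "take (n - t) (rev [1..<n]) = rev [t..<n]" by (simp add: take_rev)
  then show "mutate_list (take (Suc (2 * k + (n - t))) (long_cycle n k)) Q = descent t"
    using t by (simp add: long_cycle_eq zig_eq_mutate_list[symmetric] descent_def)
qed

text \<open>The junctions \<open>descent n\<close> and \<open>descent 1\<close> are assigned to the
  lines, and \<open>Q\<close> to position 0, so that each position below n + 4k is described
  once.\<close>

lemma position_cases:
  assumes "p < n + 4 * k"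
  obtains (line2) m where "m \<le> 2 * k" "p = Suc m" "mutate_list (take p (long_cycle n k)) Q = zig (mutate n Q) m"
  | (middle) t where "2 \<le> t" "t < n" "p = Suc (2 * k + (n - t))" "mutate_list (take p (long_cycle n k)) Q = descent t"
  | (line1) m where "m \<le> 2 * k" "p = (if m = 0 then 0 else n + 2 * k + (2 * k - m))"
      "mutate_list (take p (long_cycle n k)) Q = zig Q m"
proof -
  consider "p = 0" | "1 \<le> p" "p \<le> Suc (2 * k)" | "Suc (2 * k) < p" "p < 2 * k + n" | "2 * k + n \<le> p"
    by linarith
  then show ?thesis
  proof cases
    case 1
    then show ?thesis using line1[of 0] by simp
  next
    case 2
    then have "p - 1 \<le> 2 * k" "p = Suc (p - 1)" by auto
    then show ?thesis using line2[of "p - 1"] mutate_list_long_cycle(1)[of "p - 1"] by metis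
  next
    case 3
    define t where "t = Suc (2 * k + n) - p"
    have t: "2 \<le> t" "t < n" "p = Suc (2 * k + (n - t))" using 3 by (auto simp: t_def)
    then show ?thesis using middle[OF t] mutate_list_long_cycle(2)[of t] by simp
  next
    case 4
    define m where "m = n + 4 * k - p"
    have m: "m \<le> 2 * k" "m \<noteq> 0" "p = n + 2 * k + (2 * k - m)" using 4 assms by (auto simp: m_def)
    then show ?thesis using line1[of m] mutate_list_long_cycle(3)[of m] by simp
  qed
qed

lemma inj_on_positions: "inj_on (\<lambda>p. mutate_list (take p (long_cycle n k)) Q) {..<n + 4 * k}"
proof (rule inj_onI)
  fix p p' assume p: "p \<in> {..<n + 4 * k}" "p' \<in> {..<n + 4 * k}"
    and eq: "mutate_list (take p (long_cycle n k)) Q = mutate_list (take p' (long_cycle n k)) Q"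
  from p have p: "p < n + 4 * k" "p' < n + 4 * k" by auto
  from p(1) show "p = p'"
  proof (cases p rule: position_cases)
    case l: (line2 m)
    from p(2) show ?thesis
    proof (cases p' rule: position_cases)
      case l': (line2 m')
      have eq': "zig (mutate n Q) m = zig (mutate n Q) m'" using eq unfolding l(3) l'(3) .
      have "m = m'" using zig_inj[OF l(1) l'(1)] eq' by blast
      then show ?thesis unfolding l(2) l'(2) by (rule arg_cong)
    next
      case l': (middle t')
      have eq': "zig (mutate n Q) m = descent t'" using eq unfolding l(3) l'(4) .
      from arg_cong[OF eq', of zone] show ?thesis
        unfolding zone_zig2[OF l(1)] zone_descent[OF l'(1,2)] by (simp split: if_splits)
    next
      case l': (line1 m')
      have eq': "zig (mutate n Q) m = zig Q m'" using eq unfolding l(3) l'(3) .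
      from arg_cong[OF eq', of zone] show ?thesis
        unfolding zone_zig2[OF l(1)] zone_zig1[OF l'(1)] by (simp split: if_splits)
    qed
  next
    case l: (middle t)
    from p(2) show ?thesis
    proof (cases p' rule: position_cases)
      case l': (line2 m')
      have eq': "descent t = zig (mutate n Q) m'" using eq unfolding l(4) l'(3) .
      from arg_cong[OF eq', of zone] show ?thesis
        unfolding zone_descent[OF l(1,2)] zone_zig2[OF l'(1)] by (simp split: if_splits)
    next
      case l': (middle t')
      have eq': "descent t = descent t'" using eq unfolding l(4) l'(4) .
      have "t = t'" using descent_inj[OF l(1,2) l'(1,2) eq'] .
      then show ?thesis unfolding l(3) l'(3) by (rule arg_cong)
    next
      case l': (line1 m')
      have eq': "descent t = zig Q m'" using eq unfolding l(4) l'(3) .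
      from arg_cong[OF eq', of zone] show ?thesis
        unfolding zone_descent[OF l(1,2)] zone_zig1[OF l'(1)] by (simp split: if_splits)
    qed
  next
    case l: (line1 m)
    from p(2) show ?thesis
    proof (cases p' rule: position_cases)
      case l': (line2 m')
      have eq': "zig Q m = zig (mutate n Q) m'" using eq unfolding l(3) l'(3) .
      from arg_cong[OF eq', of zone] show ?thesis
        unfolding zone_zig1[OF l(1)] zone_zig2[OF l'(1)] by (simp split: if_splits)
    next
      case l': (middle t')
      have eq': "zig Q m = descent t'" using eq unfolding l(3) l'(4) .
      from arg_cong[OF eq', of zone] show ?thesis
        unfolding zone_zig1[OF l(1)] zone_descent[OF l'(1,2)] by (simp split: if_splits)
    next
      case l': (line1 m')
      have eq': "zig Q m = zig Q m'" using eq unfolding l(3) l'(3) .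
      have "m = m'" using zig_inj[OF l(1) l'(1)] eq' by blast
      then show ?thesis unfolding l(2) l'(2) by (rule arg_cong)
    qed
  qed
qed

lemma length_long_cycle: "length (long_cycle n k) = n + 4 * k"
  using n by (simp add: long_cycle_eq)

lemma distinct_adj_alt: "distinct_adj (map alt [i..<j])"
  by (simp add: distinct_adj_conv_nth alt_def)

lemma distinct_adj_upt: "distinct_adj [i..<j]"
  by (simp add: distinct_adj_conv_nth)

lemma mutation_cycle_long_cycle: "mutation_cycle n Q (long_cycle n k)"
  unfolding mutation_cycle_def
proof (intro conjI allI impI)
  let ?ks = "long_cycle n k"
  show qu: "is_quiver n Q" using Q_shape by (simp add: strip_shape_def)
  show "?ks \<noteq> []" by (simp add: long_cycle_eq)
  show sub: "set ?ks \<subseteq> {1..n}" using n by (auto simp: long_cycle_eq alt_def)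
  show "mutate_list ?ks Q = Q"
    using mutate_list_long_cycle(3)[of 0] length_long_cycle by simp
  have ne: "[0..<2 * k] \<noteq> []" "[1..<n] \<noteq> []" using n k by auto
  have "odd (2 * k - 1)" using k by simp
  \<comment> \<open>Equal neighbours could only occur where blocks meet: n and 1, 2 and n - 1, 1 and
    2, and cyclically 1 and n. The second pair differs because n \<ge> 4.\<close>
  then have ends: "hd (map alt [0..<2 * k]) = 1" "last (map alt [0..<2 * k]) = 2"
    "hd (rev [1..<n]) = n - 1" "last (rev [1..<n]) = 1"
    "hd (map alt (rev [0..<2 * k])) = 2" "last (map alt (rev [0..<2 * k])) = 1"
    using n k ne by (simp_all add: hd_map last_map hd_rev last_rev alt_def)
  have adj: "distinct_adj ?ks"
    unfolding long_cycle_eq distinct_adj_Cons distinct_adj_append_iff rev_map[symmetric] distinct_adj_rev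
    using n ends ne by (simp add: distinct_adj_alt distinct_adj_upt rev_map hd_append)
  have hd_last: "hd ?ks = n" "last ?ks = 1" using ends ne by (simp_all add: long_cycle_eq)
  fix j assume j: "j < length ?ks"
  show "?ks ! j \<noteq> ?ks ! (Suc j mod length ?ks)"
  proof (cases "Suc j = length ?ks")
    case True
    then have "?ks ! j = last ?ks" by (metis diff_Suc_1 last_conv_nth list.size(3) nat.distinct(1))
    moreover have "?ks ! 0 = hd ?ks" by (simp add: long_cycle_eq)
    ultimately show ?thesis using True hd_last n by simp
  next
    case False
    then show ?thesis using distinct_adj_nth[OF adj, of j] j by simp
  qed
  show "\<not> isolated (mutate_list (take j ?ks) Q) (?ks ! j)"
  proof
    let ?v = "?ks ! j"
    assume "isolated (mutate_list (take j ?ks) Q) ?v"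
    \<comment> \<open>Isolation is pulled back to \<open>Q\<close>, where every two distinct
      vertices are joined by arrows.\<close>
    then have "isolated Q ?v" by (rule isolated_mutate_listD[OF qu])
    then have 0: "Q ?v w = 0" for w by (simp add: isolated_def)
    have v: "?v \<in> {1..n}" using sub nth_mem[OF j] by blast
    have "abundant n Q" using strip.abundant[OF strip1[of 0]] k by simp
    moreover have "\<exists>w\<in>{1..n}. w \<noteq> ?v" using n by (intro bexI[of _ "if ?v = 1 then 2 else 1"]) auto
    ultimately show False using 0 v unfolding abundant_def by fastforce
  qed
qed

lemma not_paved_long_cycle: "\<not> paved n (4 * k) Q Q (long_cycle n k)"
  unfolding long_cycle_eq
proof (rule not_paved_if_edge_avoided)
  show "mutate n Q \<noteq> Q" using zig_ne[of 0 0] by simp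
  show "n \<notin> set (map alt [0..<2 * k] @ rev [1..<n] @ map alt (rev [0..<2 * k]))"
    using n by (auto simp: alt_def)
qed (rule edge_avoided)

end

theorem theorem1p1:
  fixes n k :: nat and q :: "nat \<Rightarrow> nat \<Rightarrow> int" and Q :: quiver
  assumes "n \<ge> 4" and "k \<ge> 1"
    and "\<forall>i j. 1 \<le> i \<and> i < j \<and> j \<le> n \<longrightarrow> q i j \<ge> 2"
    and "Q = long_cycle_quiver n k q"
  shows "(mutation_cycle n Q (long_cycle n k) \<and> length (long_cycle n k) = n + 4 * k)
    \<and> inj_on (\<lambda>j. mutate_list (take j (long_cycle n k)) Q) {..<n + 4 * k}
    \<and> \<not> paved n (4 * k) Q Q (long_cycle n k)"
proof -
  interpret long_cycle_data n k q Q
    using assms by unfold_locales auto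
  show ?thesis
    using mutation_cycle_long_cycle length_long_cycle inj_on_positions not_paved_long_cycle by blast
qed

end
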